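(* Let $k \geq 3$ be an integer and let $n$ be a nonzero integer. If $|n|=1$, then $M_k(n) \leq r_k$, where $r_3=9$, $r_4=6$, $r_5=5$, and $r_k=4$ for $k\ge 6$. If $|n| \geq 2$, then $M_k\left(n,\frac{k}{k-2}\right) \leq u_k$, where $u_3=15$, $u_4=10$, $u_5=6$, $u_k=8$ for $6\leq k\leq 14$, and $u_k=5$ for $k \geq 15$.
   Context: For an integer $k\ge 2$ and a nonzero integer $n$, a set $C$ of distinct positive integers has property $D_k(n)$ (is a Diophantine tuple with property $D_k(n)$) if $cc'+n$ is the $k$-th power of an integer for all distinct $c,c'\in C$. Define $M_k(n)=\sup\{|C|: C\subset\mathbb{N}\text{ has property }D_k(n)\}$ and, for real $L>0$, $M_k(n;L)=\sup\{|C\cap[|n|^L,\infty)|: C\subset\mathbb{N}\text{ has property }D_k(n)\}$ (written $M_k(n,L)$). *)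

theory Defs
  imports Complex_Main "HOL-Library.Extended_Nat"
begin

definition ecard :: "'a set \<Rightarrow> enat" where
  "ecard A = (if finite A then enat (card A) else \<infinity>)"

definition diophantine_tuple :: "nat \<Rightarrow> int \<Rightarrow> nat set \<Rightarrow> bool" where
  "diophantine_tuple k n C \<longleftrightarrow>
     (\<forall>c\<in>C. c > 0) \<and>
     (\<forall>c\<in>C. \<forall>c'\<in>C. c \<noteq> c' \<longrightarrow> (\<exists>m::int. int c * int c' + n = m ^ k))"

text \<open>A tuple may a priori be infinite, and the suprema may a priori be infinite, so both are
  taken in the extended naturals.\<close>

definition M_sup :: "nat \<Rightarrow> int \<Rightarrow> enat" where
  "M_sup k n = (SUP C \<in> {C. diophantine_tuple k n C}. ecard C)"

definition M_sup_from :: "nat \<Rightarrow> int \<Rightarrow> real \<Rightarrow> enat" where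
  "M_sup_from k n L =
     (SUP C \<in> {C. diophantine_tuple k n C}. ecard {c \<in> C. real c \<ge> real_of_int \<bar>n\<bar> powr L})"

text \<open>The values of the two bounds below are only meaningful for \<open>k \<ge> 3\<close>.\<close>

definition r_bound :: "nat \<Rightarrow> nat" where
  "r_bound k = (if k = 3 then 9 else if k = 4 then 6 else if k = 5 then 5 else 4)"

definition u_bound :: "nat \<Rightarrow> nat" where
  "u_bound k = (if k = 3 then 15 else if k = 4 then 10 else if k = 5 then 6
                else if k \<le> 14 then 8 else 5)"

end

theory Submission
  imports Defs "HOL-Computational_Algebra.Formal_Power_Series" "HOL-Number_Theory.Cong"
begin

text \<open>
  For \<open>a < b < c < d\<close> in a tuple, \<open>(ac + n)(bd + n)\<close> and \<open>(ad + n)(bc + n)\<close> are distinct \<open>k\<close>-th powers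
  whose difference \<open>n (b - a) (d - c)\<close> is small, so the elements grow doubly exponentially with
  exponent about \<open>k - 1\<close>. On the other hand, every further element \<open>c\<close> yields a solution of the Thue
  equation \<open>b x\<^sup>k - a y\<^sup>k = n (b - a)\<close>. Substituting a moderately large solution into the diagonal Pade
  approximants of \<open>x\<^sup>1\<^sup>/\<^sup>k\<close> produces a dense sequence of good rational approximations of
  \<open>(a / b)\<^sup>1\<^sup>/\<^sup>k\<close>, and comparing a second solution with it bounds that solution by a fixed power of the
  first one. The two growth rates are incompatible once the tuple is long enough.
\<close>

section \<open>Denominators of binomial coefficients\<close>

text \<open>The comparison has to be made without knowing the Pade index \<open>r\<close>. Choosing
  \<open>r\<close> minimal gives one inequality for each of the two terms, and raising these to
  integer powers \<open>M\<close> and \<open>L\<close> with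
  \<open>\<sigma> ^ M * \<rho> ^ L \<le> 1\<close> eliminates \<open>r\<close> without logarithms.
  In the result the larger solution's element \<open>d\<close> has exponent
  \<open>(k - 1) * M\<close> on one side and \<open>L\<close> on the other, so
  \<open>L < (k - 1) * M\<close> is required: \<open>M = 1\<close>, \<open>L = 2\<close> serves
  \<open>k \<ge> 4\<close>, while \<open>k = 3\<close> forces a finer pair, \<open>M = 2\<close>,
  \<open>L = 3\<close>. The balance condition asks that \<open>S\<close>, of the size of
  \<open>a 0 * a 1 * c\<close>, exceed a multiple of \<open>Df ^ 4\<close> or \<open>Df ^ 6\<close>.
  Gaps are therefore spent twice, once to lift \<open>c\<close> above this threshold and once to
  push \<open>d\<close> beyond the resulting upper bound. This takes ten elements for
  \<open>k = 3\<close>, seven for \<open>k = 4\<close>, six for \<open>k \<ge> 5\<close>, and five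
  for \<open>k \<ge> 6\<close> and \<open>\<bar>n\<bar> = 1\<close>, where the gaps are wider. The
  exponent \<open>k / (k - 2)\<close> in the size condition is what lets the factor
  \<open>\<bar>n\<bar> ^ k\<close> of the gap principle be absorbed by
  \<open>a 0 ^ (k - 2)\<close>.\<close>

lemma multiplicity_fact_rec:
  fixes p m :: nat
  assumes p: "prime p"
  shows "multiplicity p (fact m) = m div p + multiplicity p (fact (m div p))"
proof (induction m)
  case 0
  show ?case by simp
next
  case (Suc m)
  have step: "multiplicity p (fact (Suc j)) = multiplicity p (Suc j) + multiplicity p (fact j)" for j
    using p by (simp add: prime_elem_multiplicity_mult_distrib del: mult_Suc)
  show ?case
  proof (cases "p dvd Suc m")
    case False
    then have "Suc m div p = m div p"
      by (simp add: div_Suc dvd_eq_mod_eq_0)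
    with False Suc step show ?thesis
      by (simp add: not_dvd_imp_multiplicity_0)
  next
    case True
    then obtain q where q: "Suc m = p * q" by (elim dvdE)
    then obtain j where j: "q = Suc j" by (cases q) auto
    have "Suc m div p = Suc j"
      using q j p by (simp add: prime_gt_0_nat)
    moreover from this have "m div p = j"
      using True by (simp add: div_Suc dvd_eq_mod_eq_0)
    moreover have "multiplicity p (Suc m) = Suc (multiplicity p (Suc j))"
      unfolding q j using p by (intro multiplicity_times_same) auto
    ultimately show ?thesis
      using Suc step[of m] step[of j] by simp
  qed
qed

text \<open>Both summands of Legendre's recursion \<open>multiplicity_fact_rec\<close> are at most
  \<open>m div p\<close>, hence at most \<open>m / 2\<close>.\<close>

lemma multiplicity_fact_le:
  fixes p m :: nat
  assumes p: "prime p"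
  shows "multiplicity p (fact m) \<le> m"
proof (induction m rule: less_induct)
  case (less m)
  show ?case
  proof (cases "m = 0")
    case False
    have "p \<ge> 2" using p by (rule prime_ge_2_nat)
    then have "2 * (m div p) \<le> p * (m div p)" by simp
    then have "2 * (m div p) \<le> m"
      by (meson le_trans times_div_less_eq_dividend)
    moreover have "m div p < m" using False \<open>p \<ge> 2\<close> by simp
    then have "multiplicity p (fact (m div p)) \<le> m div p" by (rule less)
    ultimately show ?thesis
      using multiplicity_fact_rec[OF p, of m] by linarith
  qed simp
qed

lemma fact_dvd_prod_diff: "(fact m :: int) dvd (\<Prod>i<m. u - int i)"
  using gbinomial_int_mult_fact[of m u] unfolding atLeast0LessThan
  by (intro dvdI) (rule sym)

text \<open>Primes not dividing \<open>k\<close> are handled by inverting \<open>k\<close>, which turns the progression into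
  consecutive integers; the others divide \<open>m!\<close> at most \<open>m\<close> times.\<close>

lemma fact_dvd_power_mult_prod_progression:
  fixes k m :: nat and u :: int
  assumes "k > 0"
  shows "(fact m :: int) dvd int k ^ m * (\<Prod>i<m. u - int k * int i)"
proof -
  define g where "g = gcd (fact m) (k ^ m)"
  obtain h where h: "fact m = g * h" unfolding g_def by (metis dvdE gcd_dvd1)
  have "g > 0" "h > 0" using h by (auto intro: Nat.gr0I simp: g_def)
  \<comment> \<open>For a common prime \<open>p\<close>, the multiplicity in \<open>g\<close> is
    below that in \<open>fact m\<close>, which is at most \<open>m\<close>. So one more power of
    \<open>p\<close> than \<open>g\<close> contains divides both \<open>fact m\<close> and
    \<open>k ^ m\<close>, hence also their gcd \<open>g\<close>.\<close>
  have "coprime h k"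
  proof (rule ccontr)
    assume "\<not> coprime h k"
    then obtain p where p: "prime p" "p dvd h" "p dvd k"
      by (metis coprime_iff_gcd_eq_1 gcd_nat.boundedE prime_factor_nat)
    have "multiplicity p h \<ge> 1"
      using p \<open>h > 0\<close> by (simp add: Suc_le_eq prime_multiplicity_gt_zero_iff)
    moreover have "multiplicity p (fact m) = multiplicity p g + multiplicity p h"
      using h \<open>g > 0\<close> \<open>h > 0\<close> p by (simp add: prime_elem_multiplicity_mult_distrib)
    moreover have "p ^ Suc (multiplicity p g) dvd fact m"
      using calculation by (intro multiplicity_dvd') linarith
    moreover have "multiplicity p g < m"
      using multiplicity_fact_le[OF p(1), of m] calculation by linarith
    then have "p ^ Suc (multiplicity p g) dvd p ^ m"
      by (intro le_imp_power_dvd) simp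
    then have "p ^ Suc (multiplicity p g) dvd k ^ m"
      using p(3) by (meson dvd_power_same dvd_trans)
    ultimately have "p ^ Suc (multiplicity p g) dvd g"
      unfolding g_def by simp
    then show False
      using \<open>g > 0\<close> p(1) by (metis not_prime_unit multiplicity_geI Suc_n_not_le_n gr_implies_not0)
  qed
  then have "coprime (int k) (int h)" by (simp add: coprime_commute)
  then obtain k' where k': "[int k * k' = 1] (mod int h)"
    using cong_solve_coprime_int by blast
  have "[(\<Prod>i<m. u - int k * int i) = (\<Prod>i<m. int k * (k' * u - int i))] (mod int h)"
  proof (rule cong_prod)
    fix i
    have "[int k * k' * u - int k * int i = 1 * u - int k * int i] (mod int h)"
      by (intro cong_diff cong_mult k') auto
    then show "[u - int k * int i = int k * (k' * u - int i)] (mod int h)"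
      by (simp add: algebra_simps cong_sym_eq)
  qed
  moreover have "int h dvd (\<Prod>i<m. int k * (k' * u - int i))"
  proof -
    have "int h dvd fact m" using h by (metis dvd_triv_right of_nat_dvd_iff of_nat_fact)
    also have "fact m dvd (\<Prod>i<m. k' * u - int i)" by (rule fact_dvd_prod_diff)
    finally show ?thesis by (simp add: prod.distrib)
  qed
  ultimately have "int h dvd (\<Prod>i<m. u - int k * int i)"
    using cong_dvd_iff by (metis cong_dvd_modulus cong_sym dvd_refl cong_dvd_iff cong_0_iff cong_trans)
  moreover have "int g dvd int k ^ m"
    unfolding g_def by (metis gcd_dvd2 of_nat_dvd_iff of_nat_power)
  ultimately have "int g * int h dvd int k ^ m * (\<Prod>i<m. u - int k * int i)"
    by (rule mult_dvd_mono[rotated])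
  then show ?thesis using h by (metis of_nat_fact of_nat_mult)
qed

text \<open>One factor \<open>k ^ m\<close> clears the denominators of the terms
  \<open>u / k - i\<close>; the other pays for the primes that \<open>k\<close> shares with
  \<open>fact m\<close>.\<close>

lemma power_mult_gbinomial_Ints:
  fixes k m :: nat and u :: int
  assumes "k > 0"
  shows "real k ^ (2 * m) * ((of_int u / real k) gchoose m) \<in> \<int>"
proof -
  obtain q where q: "int k ^ m * (\<Prod>i<m. u - int k * int i) = fact m * q"
    using fact_dvd_power_mult_prod_progression[OF assms, of m u] by (elim dvdE)
  have "real k ^ m * (\<Prod>i<m. of_int u / real k - real i)
      = (\<Prod>i<m. real k * (of_int u / real k - real i))"
    by (simp add: prod.distrib)
  also have "\<dots> = (\<Prod>i<m. of_int (u - int k * int i))"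
    using assms by (intro prod.cong) (auto simp: field_simps)
  finally have "real k ^ (2 * m) * (\<Prod>i<m. of_int u / real k - real i)
      = of_int (int k ^ m * (\<Prod>i<m. u - int k * int i))"
    by (simp add: mult_2 power_add mult.assoc)
  also have "\<dots> = fact m * of_int q"
    unfolding q by simp
  finally have "real k ^ (2 * m) * ((of_int u / real k) gchoose m) = of_int q"
    by (simp add: gbinomial_prod_rev atLeast0LessThan)
  then show ?thesis by simp
qed
section \<open>Diagonal Pade approximants of the power function\<close>

text \<open>A partial fraction expansion; for positive \<open>y\<close> it is the Beta integral of
  \<open>t powr (y - 1) * (1 - t) ^ r\<close> taken termwise. By Pascal's rule the sum for
  \<open>Suc r\<close> at \<open>y\<close> is the difference of the sums for \<open>r\<close> at
  \<open>y\<close> and at \<open>y + 1\<close>. It evaluates both boundary values of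
  \<open>pade_prim\<close>.\<close>

lemma sum_alternating_binomial_divide:
  fixes y :: real
  assumes "\<And>l. l \<le> r \<Longrightarrow> y + real l \<noteq> 0"
  shows "(\<Sum>l\<le>r. (- 1) ^ l * real (r choose l) / (y + real l)) = fact r / pochhammer y (Suc r)"
  using assms
proof (induction r arbitrary: y)
  case 0
  then show ?case by simp
next
  case (Suc r)
  have nz: "pochhammer y (Suc r) \<noteq> 0" "pochhammer (y + 1) (Suc r) \<noteq> 0"
    "pochhammer (y + 1) r \<noteq> 0" "y \<noteq> 0" "y + 1 + real r \<noteq> 0"
  proof -
    show "pochhammer y (Suc r) \<noteq> 0"
      using Suc.prems by (auto simp: pochhammer_eq_0_iff eq_neg_iff_add_eq_0)
    have *: "y + 1 + real l \<noteq> 0" if "l \<le> r" for l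
      using Suc.prems[of "Suc l"] that by (simp add: add_ac)
    then show "pochhammer (y + 1) (Suc r) \<noteq> 0" "pochhammer (y + 1) r \<noteq> 0"
      by (auto simp: pochhammer_eq_0_iff eq_neg_iff_add_eq_0)
    show "y \<noteq> 0" "y + 1 + real r \<noteq> 0" using Suc.prems[of 0] *[of r] by auto
  qed
  have "(\<Sum>l\<le>Suc r. (- 1) ^ l * real (Suc r choose l) / (y + real l))
      = 1 / y + (\<Sum>l\<le>r. (- 1) ^ Suc l * real (Suc r choose Suc l) / (y + real (Suc l)))"
    by (subst sum.atMost_Suc_shift) simp
  also have "\<dots> = 1 / y + (\<Sum>l\<le>r. (- 1) ^ Suc l * real (r choose Suc l) / (y + real (Suc l)))
      - (\<Sum>l\<le>r. (- 1) ^ l * real (r choose l) / (y + 1 + real l))"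
  proof -
    have "(- 1) ^ Suc l * real (Suc r choose Suc l) / (y + real (Suc l))
      = (- 1) ^ Suc l * real (r choose Suc l) / (y + real (Suc l))
        - (- 1) ^ l * real (r choose l) / (y + 1 + real l)" for l
      by (simp add: diff_divide_distrib distrib_left add_ac)
    then show ?thesis by (simp only: sum_subtractf add_diff_eq)
  qed
  also have "1 / y + (\<Sum>l\<le>r. (- 1) ^ Suc l * real (r choose Suc l) / (y + real (Suc l)))
      = (\<Sum>l\<le>Suc r. (- 1) ^ l * real (r choose l) / (y + real l))"
    by (subst sum.atMost_Suc_shift) simp
  also have "\<dots> = (\<Sum>l\<le>r. (- 1) ^ l * real (r choose l) / (y + real l))"
    by simp
  also have "\<dots> = fact r / pochhammer y (Suc r)"
    using Suc.prems by (intro Suc.IH) auto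
  also have "(\<Sum>l\<le>r. (- 1) ^ l * real (r choose l) / (y + 1 + real l))
      = fact r / pochhammer (y + 1) (Suc r)"
    using Suc.prems[of "Suc _"] by (intro Suc.IH) (auto simp: add_ac)
  also have "fact r / pochhammer y (Suc r) - fact r / pochhammer (y + 1) (Suc r)
      = fact (Suc r) / pochhammer y (Suc (Suc r))"
  proof -
    have a: "pochhammer y (Suc r) = y * pochhammer (y + 1) r"
      by (rule pochhammer_rec)
    have b: "pochhammer (y + 1) (Suc r) = pochhammer (y + 1) r * (y + 1 + real r)"
      by (rule pochhammer_Suc)
    have c: "pochhammer y (Suc (Suc r)) = y * (pochhammer (y + 1) r * (y + 1 + real r))"
      by (subst pochhammer_rec) (simp add: b)
    show ?thesis
      unfolding a b c using nz by (simp add: divide_simps) (simp add: algebra_simps)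
  qed
  finally show ?case .
qed

text \<open>Up to a common factor, \<open>pade \<nu> r\<close> and \<open>pade (- \<nu>) r\<close>
  are the numerator and denominator of the diagonal Pade approximant of \<open>x powr \<nu>\<close>
  at \<open>x = 1\<close>. In this scaling the coefficients are positive for
  \<open>\<bar>\<nu>\<bar> < 1\<close>, and the value at \<open>1\<close> is
  \<open>2 * r choose r\<close> by Vandermonde.\<close>

definition pade :: "real \<Rightarrow> nat \<Rightarrow> real \<Rightarrow> real" where
  "pade \<nu> r x = (\<Sum>j\<le>r. ((real r + \<nu>) gchoose j) * ((real r - \<nu>) gchoose (r - j)) * x ^ j)"

text \<open>The remainder \<open>pade \<nu> r x - x\<^sup>\<nu> pade (- \<nu>) r x\<close> is a positive multiple of the integral of
  \<open>((1 - w) (w - x) / w)\<^sup>r w\<^sup>\<nu>\<^sup>-\<^sup>1\<close> over \<open>[x, 1]\<close>. With an explicit primitive no integration theory is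
  needed, and sign, size and monotonicity in \<open>r\<close> can be read off the derivative.\<close>

definition pade_prim :: "real \<Rightarrow> nat \<Rightarrow> real \<Rightarrow> real \<Rightarrow> real" where
  "pade_prim \<nu> r x w = (\<Sum>l\<le>r. \<Sum>i\<le>r. (- 1) ^ l * real (r choose l) * (real (r choose i) * (- x) ^ (r - i))
      * (w powr (\<nu> + real l + real i - real r) / (\<nu> + real l + real i - real r)))"

text \<open>This is \<open>\<nu>\<close> times the product of \<open>1 - (\<nu> / s)\<^sup>2\<close>
  over \<open>s\<close> from \<open>1\<close> to \<open>r\<close>, which explains why it lies
  between \<open>0\<close> and \<open>\<nu>\<close>.\<close>

definition pade_const :: "real \<Rightarrow> nat \<Rightarrow> real" where
  "pade_const \<nu> r = (- 1) ^ r * pochhammer (\<nu> - real r) (2 * r + 1) / (fact r)\<^sup>2"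

lemma shift_by_integer_nonzero:
  assumes "0 < \<nu>" "\<nu> < 1"
  shows "\<nu> + real_of_int s \<noteq> 0"
proof
  assume "\<nu> + real_of_int s = 0"
  then have "0 < - s" "- s < 1" using assms by linarith+
  then show False by linarith
qed

lemma pade_prim_has_real_derivative:
  assumes \<nu>: "0 < \<nu>" "\<nu> < 1" and "w > 0"
  shows "(pade_prim \<nu> r x has_real_derivative ((1 - w) * (w - x) / w) ^ r * w powr (\<nu> - 1)) (at w)"
proof -
  \<comment> \<open>As \<open>\<nu>\<close> is not an integer, no exponent vanishes and termwise
    integration produces no logarithm.\<close>
  have nz: "\<nu> + real l + real i - real r \<noteq> 0" for l i
    using shift_by_integer_nonzero[OF \<nu>, of "int l + int i - int r"] by (simp add: algebra_simps)
  have "(pade_prim \<nu> r x has_real_derivative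
     (\<Sum>l\<le>r. \<Sum>i\<le>r. (- 1) ^ l * real (r choose l) * (real (r choose i) * (- x) ^ (r - i))
      * (w powr (\<nu> + real l + real i - real r - 1)))) (at w)"
    unfolding pade_prim_def [abs_def]
    apply (intro DERIV_sum DERIV_cmult)
    subgoal for l i
      using nz[of l i] \<open>w > 0\<close> by (auto intro!: derivative_eq_intros simp: divide_simps)
    done
  also have "(\<Sum>l\<le>r. \<Sum>i\<le>r. (- 1) ^ l * real (r choose l) * (real (r choose i) * (- x) ^ (r - i))
      * (w powr (\<nu> + real l + real i - real r - 1)))
     = (\<Sum>l\<le>r. \<Sum>i\<le>r. (real (r choose l) * (- w) ^ l * 1 ^ (r - l)) * (real (r choose i) * w ^ i * (- x) ^ (r - i))
      * (w powr (\<nu> - 1) / w ^ r))"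
  proof (intro sum.cong refl)
    fix l i
    have "w powr (\<nu> + real l + real i - real r - 1) = w powr ((\<nu> - 1) + (real l + real i) - real r)"
      by (simp add: algebra_simps)
    also have "\<dots> = w powr (\<nu> - 1) * (w ^ l * w ^ i) / w ^ r"
      using \<open>w > 0\<close> by (simp only: powr_diff powr_add powr_realpow)
    finally have *: "w powr (\<nu> + real l + real i - real r - 1) = w powr (\<nu> - 1) * (w ^ l * w ^ i) / w ^ r" .
    have **: "(- w) ^ l = (- 1) ^ l * w ^ l" by (rule power_minus)
    show "(- 1) ^ l * real (r choose l) * (real (r choose i) * (- x) ^ (r - i))
      * (w powr (\<nu> + real l + real i - real r - 1)) = (real (r choose l) * (- w) ^ l * 1 ^ (r - l)) * (real (r choose i) * w ^ i * (- x) ^ (r - i))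
      * (w powr (\<nu> - 1) / w ^ r)"
      unfolding * ** by (simp add: mult_ac)
  qed
  also have "\<dots> = (- w + 1) ^ r * (w + (- x)) ^ r * (w powr (\<nu> - 1) / w ^ r)"
    unfolding binomial_ring sum_product by (simp add: sum_distrib_right sum_divide_distrib)
  also have "\<dots> = ((1 - w) * (w - x) / w) ^ r * w powr (\<nu> - 1)"
    by (simp add: power_mult_distrib power_divide)
  finally show ?thesis .
qed

text \<open>The factors \<open>\<nu> - r, ..., \<nu> + r\<close> of \<open>pade_const\<close> split
  into three consecutive blocks of \<open>r - j\<close>, \<open>r + 1\<close> and \<open>j\<close>
  terms. The middle block cancels the partial fraction denominator; the outer two are the binomial
  coefficients.\<close>

lemma pade_coeff_eq:
  assumes \<nu>: "0 < \<nu>" "\<nu> < 1" and "j \<le> r"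
  shows "pade_const \<nu> r * (real (r choose j) * (- 1) ^ j * (fact r / pochhammer (\<nu> - real j) (Suc r)))
    = ((real r + \<nu>) gchoose j) * ((real r - \<nu>) gchoose (r - j))"
proof -
  have nz: "pochhammer (\<nu> - real j) (Suc r) \<noteq> 0"
  proof
    assume "pochhammer (\<nu> - real j) (Suc r) = 0"
    then obtain i where "\<nu> - real j = - real i" by (auto simp: pochhammer_eq_0_iff)
    then show False
      using shift_by_integer_nonzero[OF \<nu>, of "int i - int j"] by simp
  qed
  have "2 * r + 1 = (r - j) + (Suc r + j)" using \<open>j \<le> r\<close> by simp
  then have "pochhammer (\<nu> - real r) (2 * r + 1) = pochhammer (\<nu> - real r) (r - j)
      * (pochhammer (\<nu> - real r + real (r - j)) (Suc r)
         * pochhammer (\<nu> - real r + real (r - j) + real (Suc r)) j)"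
    by (simp only: pochhammer_product')
  also have "\<nu> - real r + real (r - j) = \<nu> - real j" using \<open>j \<le> r\<close> by (simp add: of_nat_diff)
  also have "\<nu> - real j + real (Suc r) = (real r + \<nu>) - real j + 1" by simp
  also have "pochhammer ((real r + \<nu>) - real j + 1) j = fact j * ((real r + \<nu>) gchoose j)"
    by (simp add: gbinomial_pochhammer')
  also have "pochhammer (\<nu> - real r) (r - j) = (- 1) ^ (r - j) * fact (r - j) * ((real r - \<nu>) gchoose (r - j))"
    by (simp add: gbinomial_pochhammer)
  finally have eq: "pochhammer (\<nu> - real r) (2 * r + 1) =
     (- 1) ^ (r - j) * fact (r - j) * ((real r - \<nu>) gchoose (r - j)) *
     (pochhammer (\<nu> - real j) (Suc r) * (fact j * ((real r + \<nu>) gchoose j)))" .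
  have f: "fact j * fact (r - j) * real (r choose j) = (fact r :: real)"
    using binomial_fact_lemma[OF \<open>j \<le> r\<close>] by (metis of_nat_fact of_nat_mult)
  have s: "(- 1) ^ r * (- 1) ^ (r - j) * (- 1) ^ j = (1::real)"
    using \<open>j \<le> r\<close> by (simp add: power_add[symmetric] mult.assoc)
  have "pade_const \<nu> r * (real (r choose j) * (- 1) ^ j * (fact r / pochhammer (\<nu> - real j) (Suc r)))
    = ((- 1) ^ r * (- 1) ^ (r - j) * (- 1) ^ j) * (fact j * fact (r - j) * real (r choose j)) / fact r
      * ((real r + \<nu>) gchoose j) * ((real r - \<nu>) gchoose (r - j))"
    unfolding pade_const_def eq using nz by (simp add: field_simps power2_eq_square)
  also have "\<dots> = ((real r + \<nu>) gchoose j) * ((real r - \<nu>) gchoose (r - j))"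
    unfolding f s by simp
  finally show ?thesis .
qed

text \<open>At \<open>w = 1\<close> the sum over \<open>l\<close> is a partial fraction sum and
  leaves \<open>pade \<nu>\<close>. At \<open>w = x\<close> the powers of \<open>x\<close> combine
  to \<open>x powr \<nu> * x ^ l\<close>, so now the sum over \<open>i\<close> collapses; its
  coefficients are those at index \<open>r - l\<close>, which swaps the two binomials and leaves
  \<open>pade (- \<nu>)\<close>.\<close>

lemma pade_remainder_eq:
  assumes \<nu>: "0 < \<nu>" "\<nu> < 1" and "x > 0"
  shows "pade \<nu> r x - x powr \<nu> * pade (- \<nu>) r x
    = pade_const \<nu> r * (pade_prim \<nu> r x 1 - pade_prim \<nu> r x x)"
proof -
  have nz: "\<nu> - real j + real l \<noteq> 0" for l j
    using shift_by_integer_nonzero[OF \<nu>, of "int l - int j"] by (simp add: algebra_simps)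
  have inner: "(\<Sum>l\<le>r. (- 1) ^ l * real (r choose l) / (\<nu> - real j + real l))
      = fact r / pochhammer (\<nu> - real j) (Suc r)" for j
    by (rule sum_alternating_binomial_divide) (rule nz)
  have "pade_prim \<nu> r x 1 = (\<Sum>i\<le>r. \<Sum>l\<le>r. (- 1) ^ l * real (r choose l)
     * (real (r choose i) * (- x) ^ (r - i)) * (1 / (\<nu> + real l + real i - real r)))"
    unfolding pade_prim_def by (subst sum.swap) simp
  also have "\<dots> = (\<Sum>i\<le>r. (real (r choose i) * (- x) ^ (r - i)) * (\<Sum>l\<le>r. (- 1) ^ l * real (r choose l) / (\<nu> - real (r - i) + real l)))"
    unfolding sum_distrib_left
    by (intro sum.cong refl) (auto simp: of_nat_diff algebra_simps)
  also have "\<dots> = (\<Sum>i\<le>r. (real (r choose (r - i)) * (- x) ^ (r - i)) * (fact r / pochhammer (\<nu> - real (r - i)) (Suc r)))"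
    unfolding inner by (intro sum.cong refl) (auto simp: binomial_symmetric[symmetric])
  also have "\<dots> = (\<Sum>j\<le>r. (real (r choose j) * (- x) ^ j) * (fact r / pochhammer (\<nu> - real j) (Suc r)))"
    by (rule sum.reindex_bij_witness[of _ "\<lambda>j. r - j" "\<lambda>j. r - j"]) auto
  also have "pade_const \<nu> r * \<dots> = pade \<nu> r x"
    unfolding pade_def sum_distrib_left
    by (intro sum.cong refl)
       (auto simp: pade_coeff_eq[OF \<nu>, symmetric] power_minus[of x] mult_ac)
  finally have 1: "pade_const \<nu> r * pade_prim \<nu> r x 1 = pade \<nu> r x" .
  have "pade_prim \<nu> r x x = (\<Sum>l\<le>r. \<Sum>i\<le>r. (- 1) ^ l * real (r choose l)
     * (real (r choose i) * (- x) ^ (r - i)) * (x powr (\<nu> + real l + real i - real r) / (\<nu> + real l + real i - real r)))"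
    unfolding pade_prim_def ..
  also have "\<dots> = (\<Sum>l\<le>r. x powr \<nu> * (real (r choose l) * (- x) ^ l * (- 1) ^ r)
      * (\<Sum>i\<le>r. (- 1) ^ i * real (r choose i) / (\<nu> - real (r - l) + real i)))"
    unfolding sum_distrib_left
  proof (intro sum.cong refl)
    fix l i assume li: "l \<in> {..r}" "i \<in> {..r}"
    have "x powr (\<nu> + real l + real i - real r) = x powr (\<nu> + real l - real (r - i))"
      using li by (simp add: of_nat_diff algebra_simps)
    also have "\<dots> = x powr \<nu> * x ^ l / x ^ (r - i)"
      using \<open>x > 0\<close> by (simp only: powr_diff powr_add powr_realpow)
    finally have a: "x powr (\<nu> + real l + real i - real r) = x powr \<nu> * x ^ l / x ^ (r - i)" .
    have b: "(- x) ^ (r - i) = (- 1) ^ r * (- 1) ^ i * x ^ (r - i)"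
      using li by (simp add: power_minus[of x] power_diff minus_one_power_iff)
    have c: "\<nu> + real l + real i - real r = \<nu> - real (r - l) + real i"
      using li by (simp add: of_nat_diff)
    show "(- 1) ^ l * real (r choose l) * (real (r choose i) * (- x) ^ (r - i)) * (x powr (\<nu> + real l + real i - real r) / (\<nu> + real l + real i - real r))
      = x powr \<nu> * (real (r choose l) * (- x) ^ l * (- 1) ^ r) * ((- 1) ^ i * real (r choose i) / (\<nu> - real (r - l) + real i))"
      unfolding a unfolding c b power_minus[of x l] using \<open>x > 0\<close> by (simp add: mult_ac)
  qed
  also have "\<dots> = x powr \<nu> * (\<Sum>l\<le>r. (real (r choose (r - l)) * (- 1) ^ (r - l) * (fact r / pochhammer (\<nu> - real (r - l)) (Suc r))) * x ^ l)"
    unfolding inner sum_distrib_left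
    by (intro sum.cong refl)
       (auto simp: binomial_symmetric[symmetric] power_minus[of x] power_diff minus_one_power_iff mult_ac)
  finally have "pade_const \<nu> r * pade_prim \<nu> r x x
     = x powr \<nu> * (\<Sum>l\<le>r. (pade_const \<nu> r * (real (r choose (r - l)) * (- 1) ^ (r - l) * (fact r / pochhammer (\<nu> - real (r - l)) (Suc r)))) * x ^ l)"
    by (simp add: sum_distrib_left mult_ac)
  also have "\<dots> = x powr \<nu> * pade (- \<nu>) r x"
    unfolding pade_def
    by (intro arg_cong[of _ _ "\<lambda>y. x powr \<nu> * y"] sum.cong refl, subst pade_coeff_eq[OF \<nu>])
       (auto simp: mult_ac)
  finally have 2: "pade_const \<nu> r * pade_prim \<nu> r x x = x powr \<nu> * pade (- \<nu>) r x" .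
  show ?thesis using 1 2 by (simp add: right_diff_distrib)
qed

lemma pade_const_Suc:
  "pade_const \<nu> (Suc r) = pade_const \<nu> r * (1 - (\<nu> / real (Suc r))\<^sup>2)"
proof -
  have "pochhammer (\<nu> - real (Suc r)) (2 * Suc r + 1)
     = (\<nu> - real (Suc r)) * (pochhammer (\<nu> - real r) (2 * r + 1) * (\<nu> + real (Suc r)))"
  proof -
    have "2 * Suc r + 1 = Suc (Suc (2 * r + 1))" by simp
    then have "pochhammer (\<nu> - real (Suc r)) (2 * Suc r + 1)
      = (\<nu> - real (Suc r)) * pochhammer (\<nu> - real (Suc r) + 1) (Suc (2 * r + 1))"
      by (simp only: pochhammer_rec)
    also have "\<nu> - real (Suc r) + 1 = \<nu> - real r" by simp
    also have "pochhammer (\<nu> - real r) (Suc (2 * r + 1)) = pochhammer (\<nu> - real r) (2 * r + 1) * (\<nu> + real (Suc r))"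
      by (simp only: pochhammer_Suc) simp
    finally show ?thesis .
  qed
  then have "pade_const \<nu> (Suc r) = (- 1) ^ Suc r * ((\<nu> - real (Suc r)) *
      (pochhammer (\<nu> - real r) (2 * r + 1) * (\<nu> + real (Suc r)))) / (real (Suc r) * fact r)\<^sup>2"
    unfolding pade_const_def by simp
  also have "\<dots> = pade_const \<nu> r * (((real (Suc r))\<^sup>2 - \<nu>\<^sup>2) / (real (Suc r))\<^sup>2)"
    unfolding pade_const_def by (simp add: field_simps power2_eq_square del: of_nat_Suc)
  finally show ?thesis by (simp add: field_simps power_divide del: of_nat_Suc)
qed

lemma pade_const_bounds:
  assumes \<nu>: "0 < \<nu>" "\<nu> < 1"
  shows "0 < pade_const \<nu> r" "pade_const \<nu> (Suc r) \<le> pade_const \<nu> r" "pade_const \<nu> r \<le> \<nu>"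
proof -
  have "0 < 1 - (\<nu> / real (Suc r))\<^sup>2" for r
  proof -
    have "\<nu> / real (Suc r) < 1" "0 \<le> \<nu> / real (Suc r)" using \<nu> by (auto simp: field_simps)
    then have "(\<nu> / real (Suc r))\<^sup>2 < 1" by (simp only: abs_square_less_1 abs_of_nonneg)
    then show ?thesis by simp
  qed
  then have pos: "0 < pade_const \<nu> r" for r
    by (induction r) (use \<nu> in \<open>simp_all add: pade_const_Suc\<close>, simp add: pade_const_def)
  show "0 < pade_const \<nu> r" by (rule pos)
  have dec: "pade_const \<nu> (Suc r) \<le> pade_const \<nu> r" for r
    unfolding pade_const_Suc using pos[of r] by (simp add: mult_le_cancel_left1)
  show "pade_const \<nu> (Suc r) \<le> pade_const \<nu> r" by (rule dec)
  show "pade_const \<nu> r \<le> \<nu>"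
  proof (induction r)
    case 0 show ?case by (simp add: pade_const_def)
  next
    case (Suc r) then show ?case using dec[of r] by simp
  qed
qed

text \<open>Both \<open>1 - w\<close> and \<open>(w - x) / w = 1 - x / w\<close> are at most
  \<open>1 - x\<close>. That the kernel stays below \<open>1\<close> makes the integrals decrease in
  \<open>r\<close>.\<close>

lemma pade_kernel_bounds:
  fixes x w :: real
  assumes "0 < x" "x < w" "w < 1"
  shows "0 < (1 - w) * (w - x) / w" "(1 - w) * (w - x) / w \<le> (1 - x)\<^sup>2"
    "(1 - w) * (w - x) / w < 1"
proof -
  show "0 < (1 - w) * (w - x) / w" using assms by simp
  have "(w - x) / w \<le> 1 - x"
  proof -
    have "x * w \<le> x" using assms by simp
    then show ?thesis using assms by (simp add: field_simps)
  qed
  then have "(1 - w) * ((w - x) / w) \<le> (1 - x) * (1 - x)"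
    using assms by (intro mult_mono) auto
  then show le: "(1 - w) * (w - x) / w \<le> (1 - x)\<^sup>2" by (simp add: power2_eq_square)
  have "(1 - x)\<^sup>2 < 1" using assms by (simp add: abs_square_less_1)
  with le show "(1 - w) * (w - x) / w < 1" by linarith
qed

text \<open>Every comparison of integrals becomes the monotonicity of a difference of primitives on
  \<open>[x, 1]\<close>. In the third, the majorant is the primitive
  \<open>(1 - x) ^ (2 * r) * (w powr \<nu> / \<nu>)\<close>.\<close>

lemma pade_prim_diff_bounds:
  assumes \<nu>: "0 < \<nu>" "\<nu> < 1" and x: "0 < x" "x < 1"
  shows "pade_prim \<nu> r x x < pade_prim \<nu> r x 1"
    and "pade_prim \<nu> (Suc r) x 1 - pade_prim \<nu> (Suc r) x x < pade_prim \<nu> r x 1 - pade_prim \<nu> r x x"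
    and "pade_prim \<nu> r x 1 - pade_prim \<nu> r x x \<le> (1 - x) ^ (2 * r) * ((1 - x powr \<nu>) / \<nu>)"
proof -
  note D = pade_prim_has_real_derivative[OF \<nu>]
  have cont: "continuous_on {x..1} (pade_prim \<nu> s x)" for s
  proof (rule DERIV_atLeastAtMost_imp_continuous_on)
    fix w assume "x \<le> w" "w \<le> 1"
    then have "w > 0" using x by simp
    from D[OF this] show "\<exists>y. DERIV (pade_prim \<nu> s x) w :> y" by blast
  qed
  show "pade_prim \<nu> r x x < pade_prim \<nu> r x 1"
  proof (rule DERIV_pos_imp_increasing_open[where f = "pade_prim \<nu> r x", OF x(2) _ cont])
    fix w assume w: "x < w" "w < 1"
    have "0 < ((1 - w) * (w - x) / w) ^ r * w powr (\<nu> - 1)"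
      using pade_kernel_bounds(1)[OF x(1) w] w x by (intro mult_pos_pos zero_less_power) auto
    moreover have "0 < w" using w x by simp
    ultimately show "\<exists>y. DERIV (pade_prim \<nu> r x) w :> y \<and> 0 < y"
      using D by blast
  qed
  have "pade_prim \<nu> r x x - pade_prim \<nu> (Suc r) x x < pade_prim \<nu> r x 1 - pade_prim \<nu> (Suc r) x 1"
  proof (rule DERIV_pos_imp_increasing_open[OF x(2), where f = "\<lambda>w. pade_prim \<nu> r x w - pade_prim \<nu> (Suc r) x w"])
    fix w assume w: "x < w" "w < 1"
    let ?q = "(1 - w) * (w - x) / w"
    have "0 < ?q ^ r * (1 - ?q) * w powr (\<nu> - 1)"
      using pade_kernel_bounds[OF x(1) w] w x by (intro mult_pos_pos zero_less_power) auto
    also have "\<dots> = ?q ^ r * w powr (\<nu> - 1) - ?q ^ Suc r * w powr (\<nu> - 1)"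
      by (simp add: left_diff_distrib right_diff_distrib)
    finally have "0 < ?q ^ r * w powr (\<nu> - 1) - ?q ^ Suc r * w powr (\<nu> - 1)" .
    moreover have "0 < w" using w x by simp
    note DERIV_diff[OF D[OF this] D[OF this]]
    ultimately show "\<exists>y. DERIV (\<lambda>w. pade_prim \<nu> r x w - pade_prim \<nu> (Suc r) x w) w :> y \<and> 0 < y"
      by blast
  qed (intro continuous_on_diff cont)
  then show "pade_prim \<nu> (Suc r) x 1 - pade_prim \<nu> (Suc r) x x < pade_prim \<nu> r x 1 - pade_prim \<nu> r x x"
    by linarith
  have "(1 - x) ^ (2 * r) * (x powr \<nu> / \<nu>) - pade_prim \<nu> r x x
      \<le> (1 - x) ^ (2 * r) * (1 powr \<nu> / \<nu>) - pade_prim \<nu> r x 1"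
  proof (rule DERIV_nonneg_imp_increasing_open
      [where f = "\<lambda>w. (1 - x) ^ (2 * r) * (w powr \<nu> / \<nu>) - pade_prim \<nu> r x w"])
    fix w assume w: "x < w" "w < 1"
    let ?q = "(1 - w) * (w - x) / w"
    have "?q ^ r \<le> ((1 - x)\<^sup>2) ^ r"
      using pade_kernel_bounds(1,2)[OF x(1) w] by (intro power_mono) auto
    then have "0 \<le> ((1 - x) ^ (2 * r) - ?q ^ r) * w powr (\<nu> - 1)"
      by (simp add: power_mult)
    also have "\<dots> = (1 - x) ^ (2 * r) * w powr (\<nu> - 1) - ?q ^ r * w powr (\<nu> - 1)"
      by (rule left_diff_distrib)
    finally have "0 \<le> (1 - x) ^ (2 * r) * w powr (\<nu> - 1) - ?q ^ r * w powr (\<nu> - 1)" .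
    moreover have "0 < w" using w x by simp
    then have "DERIV (\<lambda>w. w powr \<nu> / \<nu>) w :> w powr (\<nu> - 1)"
      using \<nu> by (auto intro!: derivative_eq_intros)
    note DERIV_diff[OF DERIV_cmult[OF this] D[OF \<open>0 < w\<close>]]
    ultimately show "\<exists>y. DERIV (\<lambda>w. (1 - x) ^ (2 * r) * (w powr \<nu> / \<nu>) - pade_prim \<nu> r x w) w :> y \<and> 0 \<le> y"
      by blast
  qed (use x \<nu> in \<open>auto intro!: continuous_intros cont\<close>)
  then show "pade_prim \<nu> r x 1 - pade_prim \<nu> r x x \<le> (1 - x) ^ (2 * r) * ((1 - x powr \<nu>) / \<nu>)"
    by (simp add: diff_divide_distrib right_diff_distrib)
qed

text \<open>The last factor \<open>1 - x\<close> comes from \<open>x \<le> x powr \<nu>\<close>,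
  after \<open>pade_const \<nu> r \<le> \<nu>\<close> has cancelled the division by
  \<open>\<nu>\<close>. The strict decrease in \<open>r\<close> replaces the usual determinant
  formula when consecutive approximants have to be distinguished.\<close>

lemma pade_remainder_bounds:
  assumes \<nu>: "0 < \<nu>" "\<nu> < 1" and x: "0 < x" "x < 1"
  defines "E \<equiv> \<lambda>r. pade \<nu> r x - x powr \<nu> * pade (- \<nu>) r x"
  shows "0 < E r" "E (Suc r) < E r" "E r \<le> (1 - x) ^ (2 * r + 1)"
proof -
  define F where "F = (\<lambda>r. pade_prim \<nu> r x 1 - pade_prim \<nu> r x x)"
  have E: "E r = pade_const \<nu> r * F r" for r
    unfolding E_def F_def by (rule pade_remainder_eq[OF \<nu> x(1)])
  note c = pade_const_bounds[OF \<nu>]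
  have F: "0 < F r" "F (Suc r) < F r" "F r \<le> (1 - x) ^ (2 * r) * ((1 - x powr \<nu>) / \<nu>)" for r
    unfolding F_def using pade_prim_diff_bounds[OF \<nu> x, of r] by auto
  show "0 < E r" unfolding E using c F by simp
  have "E (Suc r) \<le> pade_const \<nu> r * F (Suc r)"
    unfolding E using c F(1)[of "Suc r"] by (intro mult_right_mono) auto
  also have "\<dots> < E r" unfolding E using c F by simp
  finally show "E (Suc r) < E r" .
  have xp: "x \<le> x powr \<nu>"
    using x \<nu> powr_mono'[of \<nu> 1 x] by simp
  have "x powr \<nu> \<le> 1" using x \<nu> by (simp add: powr_le1)
  have "E r \<le> \<nu> * ((1 - x) ^ (2 * r) * ((1 - x powr \<nu>) / \<nu>))"
    unfolding E using c[of r] F[of r] \<nu> by (intro mult_mono) auto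
  also have "\<dots> = (1 - x) ^ (2 * r) * (1 - x powr \<nu>)" using \<nu> by simp
  also have "\<dots> \<le> (1 - x) ^ (2 * r) * (1 - x)"
    using xp x by (intro mult_left_mono) auto
  finally show "E r \<le> (1 - x) ^ (2 * r + 1)" by (simp add: mult.commute)
qed

section \<open>Size and integrality of the Pade polynomials\<close>

lemma gbinomial_pos:
  fixes a :: real
  assumes "real m < a + 1"
  shows "0 < a gchoose m"
  unfolding gbinomial_prod_rev using assms by (intro divide_pos_pos prod_pos) auto

text \<open>Raising \<open>r\<close> enlarges both binomials of each term, the first by Pascal's
  rule, the second by a factor \<open>(r + \<nu> + 1) / (r - j + 1)\<close>, and adds a positive
  term. Replacing \<open>x\<close> by \<open>1\<close> bounds the sum by the Vandermonde value
  \<open>2 * r choose r\<close>.\<close>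

lemma pade_denominator_bounds:
  assumes \<nu>: "0 < \<nu>" "\<nu> < 1" and x: "0 < x" "x < 1"
  shows "0 < pade (- \<nu>) r x" "pade (- \<nu>) r x \<le> pade (- \<nu>) (Suc r) x" "pade (- \<nu>) r x \<le> 4 ^ r"
proof -
  have pos: "0 < (real r + - \<nu>) gchoose j" "0 < (real r - - \<nu>) gchoose (r - j)" if "j \<le> r" for j r
    using that \<nu> by (auto intro!: gbinomial_pos simp: of_nat_diff)
  show "0 < pade (- \<nu>) r x"
    unfolding pade_def using x by (intro sum_pos mult_pos_pos pos) auto
  have "pade (- \<nu>) r x \<le>
    (\<Sum>j\<le>r. ((real (Suc r) + - \<nu>) gchoose j) * ((real (Suc r) - - \<nu>) gchoose (Suc r - j)) * x ^ j)"
    unfolding pade_def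
  proof (intro sum_mono mult_right_mono mult_mono)
    fix j assume "j \<in> {..r}"
    then have j: "j \<le> r" by simp
    show "(real r + - \<nu>) gchoose j \<le> (real (Suc r) + - \<nu>) gchoose j"
    proof (cases j)
      case (Suc i)
      have "real (Suc r) + - \<nu> = (real r + - \<nu>) + 1" by simp
      moreover have "0 < (real r + - \<nu>) gchoose i" using Suc j by (intro pos) auto
      ultimately show ?thesis unfolding Suc by (simp only: gbinomial_Suc_Suc)
    qed simp
    have eq: "real (Suc r) - - \<nu> = (real r - - \<nu>) + 1" "Suc r - j = Suc (r - j)" using j by auto
    have "1 \<le> ((real r - - \<nu>) + 1) / real (Suc (r - j))"
      using j \<nu> by (simp add: divide_simps of_nat_diff)
    then show "(real r - - \<nu>) gchoose (r - j) \<le> (real (Suc r) - - \<nu>) gchoose (Suc r - j)"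
      unfolding eq gbinomial_rec using pos(2)[OF j]
      by (subst mult_le_cancel_left1) auto
    show "0 \<le> (real (Suc r) + - \<nu>) gchoose j" using pos(1)[of j "Suc r"] j by simp
    show "0 \<le> (real r - - \<nu>) gchoose (r - j)" using pos(2)[OF j] by simp
  qed (use x in auto)
  also have "\<dots> \<le> pade (- \<nu>) (Suc r) x"
  proof -
    have "0 \<le> ((real (Suc r) + - \<nu>) gchoose (Suc r)) * ((real (Suc r) - - \<nu>) gchoose (Suc r - Suc r)) * x ^ Suc r"
      using pos[of "Suc r" "Suc r"] x by (intro mult_nonneg_nonneg) auto
    then show ?thesis unfolding pade_def[of _ "Suc r"] by (simp only: sum.atMost_Suc)
  qed
  finally show "pade (- \<nu>) r x \<le> pade (- \<nu>) (Suc r) x" .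
  have "pade (- \<nu>) r x \<le> (\<Sum>j\<le>r. ((real r + - \<nu>) gchoose j) * ((real r - - \<nu>) gchoose (r - j)) * 1)"
    unfolding pade_def using x pos[of _ r]
    by (intro sum_mono mult_left_mono) (auto simp: power_le_one less_imp_le)
  also have "\<dots> = real (2 * r) gchoose r"
    using gbinomial_Vandermonde[of "real r + - \<nu>" "real r - - \<nu>" r] by (simp add: atMost_atLeast0)
  also have "\<dots> = real ((2 * r) choose r)"
    by (rule binomial_gbinomial[symmetric])
  also have "\<dots> \<le> real (2 ^ (2 * r))"
    by (intro of_nat_mono binomial_le_pow2)
  finally show "pade (- \<nu>) r x \<le> 4 ^ r" by (simp add: power_mult)
qed

lemma pade_Ints:
  fixes A S e :: int
  assumes "k > 0" "S \<noteq> 0"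
  shows "real k ^ (2 * r) * of_int S ^ r * pade (of_int e / real k) r (of_int A / of_int S) \<in> \<int>"
proof -
  have "real k ^ (2 * r) * of_int S ^ r * pade (of_int e / real k) r (of_int A / of_int S)
     = (\<Sum>j\<le>r. (real k ^ (2 * j) * ((of_int (int k * int r + e) / real k) gchoose j))
        * (real k ^ (2 * (r - j)) * ((of_int (int k * int r - e) / real k) gchoose (r - j)))
        * (of_int (A ^ j * S ^ (r - j))))"
    unfolding pade_def sum_distrib_left
  proof (intro sum.cong refl)
    fix j assume "j \<in> {..r}"
    then have j: "r = j + (r - j)" by simp
    have k: "real k ^ (2 * r) = real k ^ (2 * j) * real k ^ (2 * (r - j))"
      by (subst j) (simp add: power_add[symmetric] algebra_simps)
    have S: "of_int S ^ r * (of_int A / of_int S) ^ j = (of_int (A ^ j * S ^ (r - j)) :: real)"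
    proof -
      have "of_int S ^ r = of_int S ^ j * (of_int S ^ (r - j) :: real)"
        by (subst j) (rule power_add)
      then show ?thesis using assms by (simp add: power_divide)
    qed
    have e: "real r + of_int e / real k = of_int (int k * int r + e) / real k"
        "real r - of_int e / real k = of_int (int k * int r - e) / real k"
      using assms by (simp_all add: field_simps)
    have "real k ^ (2 * r) * of_int S ^ r * (((real r + of_int e / real k) gchoose j)
       * ((real r - of_int e / real k) gchoose (r - j)) * (of_int A / of_int S) ^ j)
      = real k ^ (2 * r) * ((real r + of_int e / real k) gchoose j)
       * ((real r - of_int e / real k) gchoose (r - j)) * (of_int S ^ r * (of_int A / of_int S) ^ j)"
      by (simp only: mult_ac)
    then show "real k ^ (2 * r) * of_int S ^ r * (((real r + of_int e / real k) gchoose j)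
       * ((real r - of_int e / real k) gchoose (r - j)) * (of_int A / of_int S) ^ j)
      = (real k ^ (2 * j) * ((of_int (int k * int r + e) / real k) gchoose j))
        * (real k ^ (2 * (r - j)) * ((of_int (int k * int r - e) / real k) gchoose (r - j)))
        * (of_int (A ^ j * S ^ (r - j)))"
      unfolding k S e by (simp only: mult_ac)
  qed
  also have "\<dots> \<in> \<int>"
    by (intro Ints_sum Ints_mult power_mult_gbinomial_Ints[OF assms(1)] Ints_of_int)
  finally show ?thesis .
qed
section \<open>A Thue-Siegel inequality\<close>

text \<open>\<open>(u, v)\<close> and \<open>(U, V)\<close> both approximate \<open>\<theta> = (a / b)\<^sup>1\<^sup>/\<^sup>k\<close>. The Pade approximants at
  \<open>a u\<^sup>k / (b v\<^sup>k)\<close> give further approximations of \<open>\<theta>\<close>, at least one of two consecutive ones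
  being different from \<open>V / U\<close>.\<close>

lemma thue_pade_inequality:
  fixes a b u v U V D :: int and k r :: nat
  assumes k: "k \<ge> 2" and pos: "a > 0" "b > 0" "u > 0" "v > 0" "U > 0" "V > 0" "D > 0"
    and uv: "b * v ^ k = a * u ^ k + D" and UV: "b * V ^ k = a * U ^ k + D"
  defines "S \<equiv> real_of_int (b * v ^ k)"
  shows "\<exists>s\<in>{r, Suc r}. 1 \<le> of_int (U * v * D) / S * ((real k)\<^sup>2 * (of_int D)\<^sup>2 / S) ^ s
      + of_int (u * D) / of_int (b * V ^ (k - 1)) * (4 * (real k)\<^sup>2 * S) ^ s"
proof -
  define \<nu> where "\<nu> = 1 / real k"
  define x where "x = real_of_int (a * u ^ k) / S"
  define \<theta> where "\<theta> = (real_of_int a / of_int b) powr \<nu>"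
  have \<nu>: "0 < \<nu>" "\<nu> < 1" unfolding \<nu>_def using k by auto
  have S: "S > 0" unfolding S_def using pos by simp
  have z: "1 - x = of_int D / S"
    using S unfolding x_def by (simp add: field_simps) (simp add: S_def uv)
  have x: "0 < x" "x < 1"
  proof -
    show "0 < x" unfolding x_def using pos S by simp
    have "1 - x > 0" unfolding z using pos S by simp
    then show "x < 1" by simp
  qed
  have root: "(y ^ k) powr \<nu> = y" if "y > 0" for y :: real
    using that k by (simp add: \<nu>_def powr_realpow[symmetric] powr_powr)
  have \<theta>0: "\<theta> > 0" unfolding \<theta>_def using pos by simp
  have \<theta>k: "\<theta> ^ k = of_int a / of_int b"
    using k pos by (simp add: \<theta>_def \<nu>_def powr_realpow[symmetric] powr_powr)
  \<comment> \<open>Since \<open>x\<close> is the \<open>k\<close>-th power of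
    \<open>\<theta> * u / v\<close>, approximating \<open>x powr \<nu>\<close> amounts to
    approximating a rational multiple of the fixed number \<open>\<theta>\<close>.\<close>
  have xv: "x powr \<nu> * of_int v = \<theta> * of_int u"
  proof -
    have "x = (\<theta> * of_int u / of_int v) ^ k"
      unfolding x_def S_def by (simp add: power_mult_distrib power_divide \<theta>k)
    then have "x powr \<nu> = \<theta> * of_int u / of_int v"
      using root[of "\<theta> * of_int u / of_int v"] \<theta>0 pos by simp
    then show ?thesis using pos by simp
  qed
  define P Q where "P = (\<lambda>s. pade \<nu> s x)" and "Q = (\<lambda>s. pade (- \<nu>) s x)"
  define E where "E = (\<lambda>s. P s - x powr \<nu> * Q s)"
  have E: "0 < E s" "E (Suc s) < E s" "E s \<le> (1 - x) ^ (2 * s + 1)" for s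
    unfolding E_def P_def Q_def using pade_remainder_bounds[OF \<nu> x, of s] by auto
  have Q: "0 < Q s" "Q s \<le> Q (Suc s)" "Q s \<le> 4 ^ s" for s
    unfolding Q_def using pade_denominator_bounds[OF \<nu> x, of s] by auto
  \<comment> \<open>The terms with \<open>x powr \<nu>\<close> cancel in
    \<open>E (Suc s) * Q s - E s * Q (Suc s)\<close>, so the monotonicity of \<open>E\<close> and
    \<open>Q\<close> decides the sign.\<close>
  have det: "P (Suc s) * Q s < P s * Q (Suc s)" for s
  proof -
    have "E (Suc s) * Q s < E s * Q (Suc s)"
      using E Q by (intro mult_less_le_imp_less) (auto intro: less_imp_le)
    then show ?thesis unfolding E_def by (simp add: algebra_simps)
  qed
  \<comment> \<open>If \<open>\<Delta>\<close> vanished at both \<open>r\<close> and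
    \<open>Suc r\<close>, then \<open>P / Q\<close> would take the same value there, against
    \<open>det\<close>. Once \<open>c\<close> clears the denominators, a nonzero value has absolute
    value at least \<open>1\<close>.\<close>
  define \<Delta> where "\<Delta> = (\<lambda>s. P s * of_int (v * U) - Q s * of_int (u * V))"
  have "\<exists>s\<in>{r, Suc r}. \<Delta> s \<noteq> 0"
  proof (rule ccontr)
    assume "\<not> ?thesis"
    then have *: "P r * of_int (v * U) = Q r * of_int (u * V)"
      "P (Suc r) * of_int (v * U) = Q (Suc r) * of_int (u * V)"
      unfolding \<Delta>_def by auto
    have "(P r * Q (Suc r)) * of_int (v * U) = (P r * of_int (v * U)) * Q (Suc r)" by simp
    also have "\<dots> = (P (Suc r) * of_int (v * U)) * Q r" unfolding * by simp
    finally have "(P r * Q (Suc r)) * of_int (v * U) = (P (Suc r) * Q r) * of_int (v * U)" by simp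
    then show False using det[of r] pos by simp
  qed
  then obtain s where s: "s \<in> {r, Suc r}" "\<Delta> s \<noteq> 0" by blast
  define c where "c = real k ^ (2 * s) * S ^ s"
  have c: "c > 0" unfolding c_def using k S by simp
  have "c * P s \<in> \<int>" "c * Q s \<in> \<int>"
  proof -
    have x': "x = of_int (a * u ^ k) / of_int (b * v ^ k)" unfolding x_def S_def ..
    have "b * v ^ k \<noteq> 0" "k > 0" using pos k by auto
    then show "c * P s \<in> \<int>" "c * Q s \<in> \<int>"
      unfolding c_def P_def Q_def S_def x'
      using pade_Ints[of k "b * v ^ k" s 1 "a * u ^ k"] pade_Ints[of k "b * v ^ k" s "-1" "a * u ^ k"]
      by (simp_all add: \<nu>_def)
  qed
  then have "c * P s * of_int (v * U) - c * Q s * of_int (u * V) \<in> \<int>"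
    by (intro Ints_diff Ints_mult[of "c * P s"] Ints_mult[of "c * Q s"] Ints_of_int)
  then have "c * \<Delta> s \<in> \<int>" unfolding \<Delta>_def by (simp add: algebra_simps)
  moreover have "c * \<Delta> s \<noteq> 0" using c s by simp
  ultimately have "1 \<le> \<bar>c * \<Delta> s\<bar>" by (rule Ints_nonzero_abs_ge1)
  \<comment> \<open>By \<open>xv\<close>, \<open>\<Delta> s\<close> splits into the Pade remainder
    of the first solution and the error \<open>V - \<theta> * U\<close> of the second one.\<close>
  also have "c * \<Delta> s = of_int (U * v) * c * E s - of_int u * (c * Q s) * (of_int V - \<theta> * of_int U)"
  proof -
    have "of_int (U * v) * c * E s = c * P s * of_int (v * U) - c * Q s * of_int U * (x powr \<nu> * of_int v)"
      unfolding E_def by (simp add: algebra_simps)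
    then show ?thesis unfolding xv \<Delta>_def by (simp add: algebra_simps)
  qed
  also have "\<bar>\<dots>\<bar> \<le> \<bar>of_int (U * v) * c * E s\<bar> + \<bar>of_int u * (c * Q s) * (of_int V - \<theta> * of_int U)\<bar>"
    by (rule abs_triangle_ineq4)
  also have "\<bar>of_int (U * v) * c * E s\<bar> \<le> of_int (U * v) * c * (of_int D / S) ^ (2 * s + 1)"
  proof -
    have "0 \<le> of_int (U * v) * c" using pos c by simp
    moreover have "\<bar>E s\<bar> \<le> (of_int D / S) ^ (2 * s + 1)" using E[of s] unfolding z by simp
    ultimately show ?thesis unfolding abs_mult[of _ "E s"] by (metis abs_of_nonneg mult_left_mono)
  qed
  also have "\<dots> = of_int (U * v * D) / S * ((real k)\<^sup>2 * (of_int D)\<^sup>2 / S) ^ s"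
  proof -
    have "c * (of_int D / S) ^ (2 * s) = ((real k)\<^sup>2 * S * (of_int D / S)\<^sup>2) ^ s"
      unfolding c_def power_mult power_mult_distrib ..
    also have "(real k)\<^sup>2 * S * (of_int D / S)\<^sup>2 = (real k)\<^sup>2 * (of_int D)\<^sup>2 / S"
      using S by (simp add: power_divide power2_eq_square)
    finally show ?thesis by (simp add: mult_ac)
  qed
  also have "\<bar>of_int u * (c * Q s) * (of_int V - \<theta> * of_int U)\<bar>
      \<le> of_int u * (c * 4 ^ s) * (of_int D / of_int (b * V ^ (k - 1)))"
  proof -
    define y where "y = \<theta> * real_of_int U"
    have y0: "y > 0" unfolding y_def using \<theta>0 pos by simp
    obtain k' where k': "k = Suc k'" using k by (cases k) auto
    have yk: "real_of_int V ^ k = y ^ k + of_int D / of_int b"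
    proof -
      have "real_of_int b * of_int V ^ k = of_int a * of_int U ^ k + of_int D"
        using UV by (metis of_int_add of_int_mult of_int_power)
      then show ?thesis
        unfolding y_def power_mult_distrib \<theta>k using pos by (simp add: field_simps)
    qed
    then have "y ^ k < of_int V ^ k" using pos by simp
    then have yV: "y < of_int V" by (rule power_less_imp_less_base) (use pos in simp)
    have "y ^ k' * y \<le> of_int V ^ k' * y"
      using yV y0 by (intro mult_right_mono power_mono) auto
    then have "of_int V ^ k' * (of_int V - y) \<le> of_int V ^ k - y ^ k"
      unfolding k' by (simp add: algebra_simps)
    then have "of_int V ^ k' * (of_int V - y) \<le> of_int D / of_int b" using yk by simp
    then have "of_int V - y \<le> of_int D / of_int (b * V ^ (k - 1))"
      using pos unfolding k' by (simp add: field_simps)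
    then have "of_int u * (c * Q s) * (of_int V - y)
        \<le> of_int u * (c * 4 ^ s) * (of_int D / of_int (b * V ^ (k - 1)))"
      using pos c Q[of s] yV by (intro mult_mono) auto
    moreover have "0 \<le> of_int u * (c * Q s) * (of_int V - y)"
      using pos c Q[of s] yV by (intro mult_nonneg_nonneg) auto
    ultimately show ?thesis unfolding y_def[symmetric] by simp
  qed
  also have "\<dots> = of_int (u * D) / of_int (b * V ^ (k - 1)) * (4 * (real k)\<^sup>2 * S) ^ s"
    unfolding c_def by (simp add: power_mult_distrib power_mult)
  finally show ?thesis using s(1) by (intro bexI[of _ s]) auto
qed

text \<open>Take the least \<open>r\<close> with \<open>\<alpha> * \<rho> ^ r < 1 / 2\<close>. Then
  the other term forces \<open>1 \<le> 2 * \<beta> * \<sigma> ^ (r + 1)\<close>. If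
  \<open>r = 0\<close>, this is the first alternative. Otherwise minimality gives
  \<open>1 \<le> 2 * \<alpha> * \<rho> ^ (r - 1)\<close>, and in the product of the
  \<open>M\<close>-th and \<open>L\<close>-th powers the unknown \<open>r\<close> survives only in
  \<open>(\<sigma> ^ M * \<rho> ^ L) ^ (r - 1)\<close>, which is at most \<open>1\<close>.\<close>

lemma balanced_exponent_bound:
  fixes \<alpha> \<beta> \<rho> \<sigma> :: real
  assumes pos: "\<alpha> > 0" "\<beta> > 0" "0 < \<rho>" "\<rho> < 1" "\<sigma> \<ge> 1" and bal: "\<sigma> ^ M * \<rho> ^ L \<le> 1"
    and ineq: "\<And>r. \<exists>s\<in>{r, Suc r}. 1 \<le> \<alpha> * \<rho> ^ s + \<beta> * \<sigma> ^ s"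
  shows "1 \<le> 2 * \<beta> * \<sigma> \<or> 1 \<le> (2 * \<beta>) ^ M * \<sigma> ^ (2 * M) * (2 * \<alpha>) ^ L"
proof -
  have "(\<lambda>r. \<alpha> * \<rho> ^ r) \<longlonglongrightarrow> \<alpha> * 0"
    using pos by (intro tendsto_mult tendsto_const LIMSEQ_realpow_zero) auto
  then have "\<forall>\<^sub>F r in sequentially. \<alpha> * \<rho> ^ r < 1 / 2"
    by (rule order_tendstoD) simp
  then have ex: "\<exists>r. \<alpha> * \<rho> ^ r < 1 / 2"
    by (meson eventually_happens trivial_limit_sequentially)
  define r where "r = (LEAST r. \<alpha> * \<rho> ^ r < 1 / 2)"
  have r: "\<alpha> * \<rho> ^ r < 1 / 2" unfolding r_def using ex by (rule LeastI_ex)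
  have least: "\<not> \<alpha> * \<rho> ^ j < 1 / 2" if "j < r" for j
    using that unfolding r_def by (rule not_less_Least)
  obtain s where s: "s \<in> {r, Suc r}" "1 \<le> \<alpha> * \<rho> ^ s + \<beta> * \<sigma> ^ s" using ineq by blast
  have "\<rho> ^ s \<le> \<rho> ^ r" using s(1) pos by (auto intro: power_decreasing)
  then have "\<alpha> * \<rho> ^ s \<le> \<alpha> * \<rho> ^ r" using pos by simp
  moreover have "\<sigma> ^ s \<le> \<sigma> ^ Suc r" using s(1) pos by (intro power_increasing) auto
  then have "\<beta> * \<sigma> ^ s \<le> \<beta> * \<sigma> ^ Suc r" using pos by (intro mult_left_mono) auto
  ultimately have main: "1 \<le> 2 * \<beta> * \<sigma> ^ Suc r" using r s(2) by linarith
  show ?thesis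
  proof (cases r)
    case 0
    then show ?thesis using main by simp
  next
    case (Suc t)
    have "1 \<le> 2 * \<alpha> * \<rho> ^ t" using least[of t] Suc by simp
    then have "1 \<le> (2 * \<alpha> * \<rho> ^ t) ^ L" by (rule one_le_power)
    moreover have "1 \<le> (2 * \<beta> * \<sigma> ^ Suc r) ^ M" using main by (rule one_le_power)
    ultimately have "1 * 1 \<le> (2 * \<beta> * \<sigma> ^ Suc r) ^ M * (2 * \<alpha> * \<rho> ^ t) ^ L"
      by (intro mult_mono) auto
    also have "\<dots> = (2 * \<beta>) ^ M * \<sigma> ^ (2 * M) * (2 * \<alpha>) ^ L * (\<sigma> ^ M * \<rho> ^ L) ^ t"
    proof -
      have "\<sigma> ^ (2 * M) = \<sigma> ^ M * \<sigma> ^ M" by (simp add: mult_2 power_add)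
      then show ?thesis
        unfolding Suc power_mult_distrib power_mult[symmetric] by (simp add: power_add mult_ac)
    qed
    also have "\<dots> \<le> (2 * \<beta>) ^ M * \<sigma> ^ (2 * M) * (2 * \<alpha>) ^ L * 1"
      using pos bal by (intro mult_left_mono power_le_one) auto
    finally show ?thesis by simp
  qed
qed

text \<open>\<open>balanced_exponent_bound\<close> is raised to the \<open>k\<close>-th power,
  because in the application the known quantities are \<open>u ^ k\<close>, \<open>v ^ k\<close>,
  \<open>U ^ k\<close> and \<open>V ^ k\<close>, not the roots.\<close>

lemma thue_power_bound:
  fixes a b u v U V D :: int and k M L :: nat and p q w :: real
  assumes k: "k \<ge> 2" and pos: "a > 0" "b > 0" "u > 0" "v > 0" "U > 0" "V > 0" "D > 0"
    and uv: "b * v ^ k = a * u ^ k + D" and UV: "b * V ^ k = a * U ^ k + D"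
    and bnd: "of_int u ^ k \<le> p" "of_int v ^ k \<le> p" "of_int U ^ k \<le> q" "w \<le> of_int V ^ k" "0 < w"
  defines "S \<equiv> real_of_int (b * v ^ k)"
  assumes less: "(real k)\<^sup>2 * (of_int D)\<^sup>2 < S"
    and bal: "(4 * (real k)\<^sup>2 * S) ^ M * ((real k)\<^sup>2 * (of_int D)\<^sup>2 / S) ^ L \<le> 1"
  shows "w ^ (k - 1) \<le> (8 * (real k)\<^sup>2 * S * of_int D) ^ k * p \<or>
    (w ^ (k - 1)) ^ M \<le> ((2 * of_int D) ^ M * (4 * (real k)\<^sup>2 * S) ^ (2 * M) * (2 * of_int D / S) ^ L) ^ k
      * p ^ (M + L) * q ^ L"
proof -
  define B where "B = real_of_int (b * V ^ (k - 1))"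
  define \<sigma> where "\<sigma> = 4 * (real k)\<^sup>2 * S"
  have S: "S \<ge> 1" unfolding S_def using pos by (metis of_int_1_le_iff int_one_le_iff_zero_less mult_pos_pos zero_less_power)
  have B: "B > 0" unfolding B_def using pos by simp
  have k2: "(real k)\<^sup>2 \<ge> 1" using k by (simp add: one_le_power)
  have \<sigma>: "\<sigma> \<ge> 1"
  proof -
    have "1 * 1 \<le> (real k)\<^sup>2 * S" using k2 S by (intro mult_mono) auto
    then show ?thesis unfolding \<sigma>_def by simp
  qed
  have pq: "0 < p" "0 < q"
    using bnd(1,3) pos by (meson less_le_trans of_int_0_less_iff zero_less_power)+
  have "1 \<le> 2 * (of_int (u * D) / B) * \<sigma> \<or>
      1 \<le> (2 * (of_int (u * D) / B)) ^ M * \<sigma> ^ (2 * M) * (2 * (of_int (U * v * D) / S)) ^ L"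
  proof (rule balanced_exponent_bound)
    show "(real k)\<^sup>2 * (of_int D)\<^sup>2 / S < 1" using less S by simp
    show "0 < (real k)\<^sup>2 * (of_int D)\<^sup>2 / S" using k2 S pos k by simp
    show "\<sigma> ^ M * ((real k)\<^sup>2 * (of_int D)\<^sup>2 / S) ^ L \<le> 1" unfolding \<sigma>_def by (rule bal)
    show "\<exists>s\<in>{r, Suc r}. 1 \<le> of_int (U * v * D) / S * ((real k)\<^sup>2 * (of_int D)\<^sup>2 / S) ^ s
      + of_int (u * D) / B * \<sigma> ^ s" for r
      unfolding \<sigma>_def B_def S_def by (rule thue_pade_inequality[OF k pos uv UV])
  qed (use S B \<sigma> pos in auto)
  \<comment> \<open>The coefficient \<open>b\<close> of \<open>B\<close> is dropped, and
    \<open>(V ^ (k - 1)) ^ k\<close> is rewritten as \<open>(V ^ k) ^ (k - 1)\<close>.\<close>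
  moreover have VB: "w ^ (k - 1) \<le> B ^ k"
  proof -
    have "of_int V ^ (k - 1) \<le> B"
      unfolding B_def using pos by (simp add: mult_le_cancel_right1)
    then have "(of_int V ^ (k - 1)) ^ k \<le> B ^ k" using pos by (intro power_mono) auto
    moreover have "w ^ (k - 1) \<le> (of_int V ^ k) ^ (k - 1)" using bnd by (intro power_mono) auto
    ultimately show ?thesis by (simp add: power_mult[symmetric] mult.commute)
  qed
  ultimately show ?thesis
  proof (elim disjE)
    assume "1 \<le> 2 * (of_int (u * D) / B) * \<sigma>"
    then have "B \<le> 8 * (real k)\<^sup>2 * S * of_int D * of_int u"
      using B unfolding \<sigma>_def by (simp add: field_simps)
    then have "B ^ k \<le> (8 * (real k)\<^sup>2 * S * of_int D * of_int u) ^ k"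
      using B by (intro power_mono) auto
    also have "\<dots> = (8 * (real k)\<^sup>2 * S * of_int D) ^ k * of_int u ^ k"
      by (rule power_mult_distrib)
    also have "\<dots> \<le> (8 * (real k)\<^sup>2 * S * of_int D) ^ k * p"
      using bnd S pos by (intro mult_left_mono) auto
    finally show ?thesis using VB by simp
  next
    assume *: "1 \<le> (2 * (of_int (u * D) / B)) ^ M * \<sigma> ^ (2 * M) * (2 * (of_int (U * v * D) / S)) ^ L"
    have e1: "B ^ M * (2 * (of_int (u * D) / B)) ^ M = (2 * of_int D) ^ M * of_int u ^ M"
    proof -
      have "B * (2 * (of_int (u * D) / B)) = (2 * of_int D) * of_int u" using B by simp
      then show ?thesis by (simp only: power_mult_distrib[symmetric])
    qed
    have e2: "(2 * (of_int (U * v * D) / S)) ^ L = (2 * of_int D / S) ^ L * of_int (U * v) ^ L"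
    proof -
      have "2 * (of_int (U * v * D) / S) = (2 * of_int D / S) * of_int (U * v)" by simp
      then show ?thesis by (simp only: power_mult_distrib[symmetric])
    qed
    have "B ^ M * 1 \<le> B ^ M * ((2 * (of_int (u * D) / B)) ^ M * \<sigma> ^ (2 * M) * (2 * (of_int (U * v * D) / S)) ^ L)"
      using * B by (intro mult_left_mono) auto
    also have "\<dots> = (B ^ M * (2 * (of_int (u * D) / B)) ^ M) * \<sigma> ^ (2 * M) * (2 * (of_int (U * v * D) / S)) ^ L"
      by (simp only: mult.assoc)
    also have "\<dots> = ((2 * of_int D) ^ M * \<sigma> ^ (2 * M) * (2 * of_int D / S) ^ L) * (of_int u ^ M * of_int (U * v) ^ L)"
      unfolding e1 e2 by (simp only: mult_ac)
    finally have "B ^ M \<le> ((2 * of_int D) ^ M * \<sigma> ^ (2 * M) * (2 * of_int D / S) ^ L) * (of_int u ^ M * of_int (U * v) ^ L)"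
      by simp
    then have "(B ^ M) ^ k \<le> (((2 * of_int D) ^ M * \<sigma> ^ (2 * M) * (2 * of_int D / S) ^ L) * (of_int u ^ M * of_int (U * v) ^ L)) ^ k"
      using B by (intro power_mono) auto
    also have "\<dots> = ((2 * of_int D) ^ M * \<sigma> ^ (2 * M) * (2 * of_int D / S) ^ L) ^ k
       * ((of_int u ^ k) ^ M * (of_int v ^ k) ^ L * (of_int U ^ k) ^ L)"
      by (simp add: power_mult_distrib power_mult[symmetric] mult_ac)
    also have "\<dots> \<le> ((2 * of_int D) ^ M * \<sigma> ^ (2 * M) * (2 * of_int D / S) ^ L) ^ k * (p ^ M * p ^ L * q ^ L)"
      using bnd pos pq S \<sigma> by (intro mult_left_mono mult_mono power_mono) auto
    finally have "(B ^ k) ^ M \<le> ((2 * of_int D) ^ M * \<sigma> ^ (2 * M) * (2 * of_int D / S) ^ L) ^ k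
      * p ^ (M + L) * q ^ L"
      by (simp add: power_add power_mult[symmetric] mult_ac)
    moreover have "(w ^ (k - 1)) ^ M \<le> (B ^ k) ^ M"
      using VB bnd by (intro power_mono) auto
    ultimately show ?thesis unfolding \<sigma>_def by linarith
  qed
qed

section \<open>Gaps and Thue equations in Diophantine tuples\<close>

text \<open>As \<open>a * b + n\<close> is positive, \<open>\<bar>m\<bar>\<close> is a root too,
  whatever the parity of \<open>k\<close>.\<close>

lemma diophantine_tuple_root:
  assumes "diophantine_tuple k n C" "a \<in> C" "b \<in> C" "a \<noteq> b" "\<bar>n\<bar> < int a * int b" "k > 0"
  obtains m :: int where "m > 0" "int a * int b + n = m ^ k"
proof -
  obtain m where m: "int a * int b + n = m ^ k"
    using assms unfolding diophantine_tuple_def by blast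
  have "m ^ k > 0" using m assms(5) by linarith
  then have "\<bar>m\<bar> ^ k = m ^ k" by (metis power_abs abs_of_pos)
  moreover have "m \<noteq> 0" using \<open>m ^ k > 0\<close> assms(6) by (metis less_irrefl zero_power)
  ultimately show ?thesis using m by (intro that[of "\<bar>m\<bar>"]) auto
qed

lemma power_diff_ge:
  fixes x y :: int
  assumes "0 < y" "y < x" "k > 0"
  shows "int k * y ^ (k - 1) \<le> x ^ k - y ^ k"
proof -
  have "y ^ k + int k * y ^ (k - 1) \<le> (y + 1) ^ k"
    using \<open>k > 0\<close>
  proof (induction k)
    case (Suc j)
    show ?case
    proof (cases "j = 0")
      case False
      then have "y ^ j + int j * y ^ (j - 1) \<le> (y + 1) ^ j" using Suc by simp
      then have "(y ^ j + int j * y ^ (j - 1)) * (y + 1) \<le> (y + 1) ^ Suc j"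
        using assms by (simp add: mult.commute mult_left_mono)
      moreover have "(y ^ j + int j * y ^ (j - 1)) * (y + 1) = y ^ Suc j + int (Suc j) * y ^ j + int j * y ^ (j - 1)"
        using False by (cases j) (auto simp: algebra_simps)
      moreover have "0 \<le> int j * y ^ (j - 1)" using assms by simp
      ultimately show ?thesis by simp
    qed simp
  qed simp
  moreover have "(y + 1) ^ k \<le> x ^ k" using assms by (intro power_mono) auto
  ultimately show ?thesis by linarith
qed

text \<open>The distinct powers \<open>(p * q) ^ k\<close> and \<open>(s * t) ^ k\<close> are both
  at least \<open>X * Y\<close>, so they differ by at least \<open>k * m ^ (k - 1)\<close> with
  \<open>m ^ k \<ge> X * Y\<close>, yet by at most \<open>\<bar>n\<bar> * Y\<close>. The
  \<open>k\<close>-th power of this comparison loses a factor \<open>Y ^ (k - 1)\<close> on both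
  sides.\<close>

lemma diophantine_gap:
  fixes a b c d k :: nat and n :: int
  assumes C: "diophantine_tuple k n C" "a \<in> C" "b \<in> C" "c \<in> C" "d \<in> C"
    and ord: "a < b" "b < c" "c < d" and n: "\<bar>n\<bar> < int a * int c" "n \<noteq> 0" and k: "k > 0"
  shows "real k ^ k * (real a * real c - of_int \<bar>n\<bar>) ^ (k - 1) \<le> of_int \<bar>n\<bar> ^ k * (real b * real d)"
proof -
  define N where "N = \<bar>n\<bar>"
  define X where "X = int a * int c - N"
  define Y where "Y = int b * int d - N"
  have N0: "N > 0" unfolding N_def using n by simp
  have X0: "X > 0" unfolding X_def N_def using n by simp
  have lt: "int a * int c < int b * int c" "int a * int c < int a * int d" "int b * int c < int b * int d"
    using ord n(1) by (auto intro!: mult_strict_right_mono mult_strict_left_mono)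
      (use n(1) in \<open>cases a; simp\<close>)
  have Y0: "Y > 0" unfolding Y_def using lt X0 unfolding X_def by linarith
  have big_ac: "\<bar>n\<bar> < int a * int c" and big_bd: "\<bar>n\<bar> < int b * int d"
    and big_ad: "\<bar>n\<bar> < int a * int d" and big_bc: "\<bar>n\<bar> < int b * int c"
    using lt n by linarith+
  obtain p where p: "p > 0" "int a * int c + n = p ^ k"
    by (rule diophantine_tuple_root[OF C(1,2,4) _ big_ac]) (use ord k in auto)
  obtain q where q: "q > 0" "int b * int d + n = q ^ k"
    by (rule diophantine_tuple_root[OF C(1,3,5) _ big_bd]) (use ord k in auto)
  obtain s where s: "s > 0" "int a * int d + n = s ^ k"
    by (rule diophantine_tuple_root[OF C(1,2,5) _ big_ad]) (use ord k in auto)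
  obtain t where t: "t > 0" "int b * int c + n = t ^ k"
    by (rule diophantine_tuple_root[OF C(1,3,4) _ big_bc]) (use ord k in auto)
  have diff: "(p * q) ^ k - (s * t) ^ k = n * ((int b - int a) * (int d - int c))"
    unfolding power_mult_distrib p(2)[symmetric] q(2)[symmetric] s(2)[symmetric] t(2)[symmetric]
    by (simp add: algebra_simps)
  have bd0: "(int b - int a) * (int d - int c) > 0" using ord by simp
  have low1: "X * Y \<le> (p * q) ^ k"
    unfolding power_mult_distrib p(2)[symmetric] q(2)[symmetric] X_def Y_def N_def
    using X0 Y0 unfolding X_def Y_def N_def by (intro mult_mono) auto
  \<comment> \<open>The sign of \<open>n\<close> decides which product is smaller: for
    \<open>n < 0\<close> it is \<open>p * q\<close>, already treated; for \<open>n \<ge> 0\<close>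
    adding \<open>n\<close> only helps.\<close>
  have low2: "X * Y \<le> (s * t) ^ k"
  proof (cases "n < 0")
    case True
    then have "n * ((int b - int a) * (int d - int c)) < 0" using bd0 by (simp add: mult_neg_pos)
    then show ?thesis using low1 diff by linarith
  next
    case False
    have "X * Y \<le> (int a * int c) * (int b * int d)"
      using X0 Y0 N0 unfolding X_def Y_def by (intro mult_mono) auto
    also have "\<dots> = (int a * int d) * (int b * int c)" by simp
    also have "\<dots> \<le> (int a * int d + n) * (int b * int c + n)"
      using False by (intro mult_mono) auto
    finally show ?thesis unfolding power_mult_distrib s(2) t(2) .
  qed
  define m where "m = min (p * q) (s * t)"
  have m0: "m > 0" unfolding m_def using p q s t by simp
  have "p * q \<noteq> s * t" using diff bd0 n by auto
  then have "int k * m ^ (k - 1) \<le> \<bar>(p * q) ^ k - (s * t) ^ k\<bar>"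
    using power_diff_ge[of m "p * q" k] power_diff_ge[of m "s * t" k] m0 k unfolding m_def by linarith
  also have "\<dots> = N * ((int b - int a) * (int d - int c))"
    unfolding diff N_def abs_mult[of n] abs_of_pos[OF bd0] ..
  also have "\<dots> \<le> N * Y"
  proof -
    have "(int b - int a) * (int d - int c) = int b * int d - int b * int c - int a * int d + int a * int c"
      by (simp add: algebra_simps)
    also have "\<dots> \<le> Y" using lt X0 unfolding Y_def X_def by linarith
    finally show ?thesis using N0 by simp
  qed
  finally have "(int k * m ^ (k - 1)) ^ k \<le> (N * Y) ^ k"
    using m0 by (intro power_mono) auto
  then have "int k ^ k * (m ^ k) ^ (k - 1) \<le> N ^ k * Y ^ k"
    by (simp add: power_mult_distrib power_mult[symmetric] mult.commute)
  moreover have "(X * Y) ^ (k - 1) \<le> (m ^ k) ^ (k - 1)"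
    using low1 low2 X0 Y0 unfolding m_def by (intro power_mono) (auto simp: min_def)
  then have "int k ^ k * (X * Y) ^ (k - 1) \<le> int k ^ k * (m ^ k) ^ (k - 1)"
    by (intro mult_left_mono) auto
  ultimately have "int k ^ k * (X * Y) ^ (k - 1) \<le> N ^ k * Y ^ k" by linarith
  then have "(int k ^ k * X ^ (k - 1)) * Y ^ (k - 1) \<le> (N ^ k * Y) * Y ^ (k - 1)"
    using k by (cases k) (auto simp: power_mult_distrib mult_ac)
  then have "int k ^ k * X ^ (k - 1) \<le> N ^ k * Y"
    using Y0 by (simp add: mult_le_cancel_right)
  also have "\<dots> \<le> N ^ k * (int b * int d)"
    using N0 unfolding Y_def by (intro mult_left_mono) auto
  finally have "real_of_int (int k ^ k * X ^ (k - 1)) \<le> of_int (N ^ k * (int b * int d))"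
    by (simp only: of_int_le_iff)
  then show ?thesis unfolding X_def N_def by simp
qed

text \<open>The element \<open>c\<close> supplies the smaller and \<open>d\<close> the larger
  solution. For positive \<open>n\<close> the equation reads
  \<open>b * y1 ^ k - a * y2 ^ k = D\<close>; for negative \<open>n\<close> the roles of
  \<open>a\<close> and \<open>b\<close> are exchanged to keep \<open>D\<close> positive. The bounds
  with \<open>2 * b * c\<close>, \<open>2 * b * d\<close> and \<open>a * d / 2\<close> are symmetric
  enough to cover both cases.\<close>

lemma diophantine_thue:
  fixes a b c d k :: nat and n :: int
  assumes C: "diophantine_tuple k n C" "a \<in> C" "b \<in> C" "c \<in> C" "d \<in> C"
    and ord: "a < b" "b < c" "c < d" and n: "2 * \<bar>n\<bar> \<le> int a * int c" "n \<noteq> 0" and k: "k \<ge> 2"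
  defines "D \<equiv> of_int \<bar>n\<bar> * (real b - real a)"
  obtains S :: real where "real a * real b * real c / 2 \<le> S" "S \<le> 2 * (real a * real b * real c)"
    "\<And>M L. (real k)\<^sup>2 * D\<^sup>2 < S \<Longrightarrow> (4 * (real k)\<^sup>2 * S) ^ M * ((real k)\<^sup>2 * D\<^sup>2 / S) ^ L \<le> 1 \<Longrightarrow>
      (real a * real d / 2) ^ (k - 1) \<le> (8 * (real k)\<^sup>2 * S * D) ^ k * (2 * real b * real c) \<or>
      ((real a * real d / 2) ^ (k - 1)) ^ M \<le> ((2 * D) ^ M * (4 * (real k)\<^sup>2 * S) ^ (2 * M) * (2 * D / S) ^ L) ^ k
      * (2 * real b * real c) ^ (M + L) * (2 * real b * real d) ^ L"
proof -
  define N where "N = \<bar>n\<bar>"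
  define D' where "D' = N * (int b - int a)"
  have D': "D = of_int D'" unfolding D_def D'_def N_def by simp
  have N0: "N > 0" unfolding N_def using n by simp
  have D0: "D' > 0" unfolding D'_def using N0 ord by simp
  have a0: "a > 0" using n by (cases a) auto
  have lt: "int a * int c < int b * int c" "int a * int c < int a * int d" "int b * int c < int b * int d"
    "int a * int d < int b * int d"
    using ord a0 by (auto intro!: mult_strict_right_mono mult_strict_left_mono)
  have big_ac: "\<bar>n\<bar> < int a * int c" and big_bd: "\<bar>n\<bar> < int b * int d"
    and big_ad: "\<bar>n\<bar> < int a * int d" and big_bc: "\<bar>n\<bar> < int b * int c"
    using lt n by linarith+
  obtain y1 where y1: "y1 > 0" "int a * int c + n = y1 ^ k"
    by (rule diophantine_tuple_root[OF C(1,2,4) _ big_ac]) (use ord k in auto)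
  obtain x2 where x2: "x2 > 0" "int b * int d + n = x2 ^ k"
    by (rule diophantine_tuple_root[OF C(1,3,5) _ big_bd]) (use ord k in auto)
  obtain x1 where x1: "x1 > 0" "int a * int d + n = x1 ^ k"
    by (rule diophantine_tuple_root[OF C(1,2,5) _ big_ad]) (use ord k in auto)
  obtain y2 where y2: "y2 > 0" "int b * int c + n = y2 ^ k"
    by (rule diophantine_tuple_root[OF C(1,3,4) _ big_bc]) (use ord k in auto)
  have up: "of_int y1 ^ k \<le> 2 * real b * real c" "of_int y2 ^ k \<le> 2 * real b * real c"
    "of_int x1 ^ k \<le> 2 * real b * real d" "of_int x2 ^ k \<le> 2 * real b * real d"
    "real a * real d / 2 \<le> of_int x1 ^ k" "real a * real d / 2 \<le> of_int x2 ^ k"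
  proof -
    have "y1 ^ k \<le> 2 * (int b * int c)" "y2 ^ k \<le> 2 * (int b * int c)"
      "x1 ^ k \<le> 2 * (int b * int d)" "x2 ^ k \<le> 2 * (int b * int d)"
      "int a * int d \<le> 2 * x1 ^ k" "int a * int d \<le> 2 * x2 ^ k"
      using y1(2) y2(2) x1(2) x2(2) lt n N0 unfolding N_def by linarith+
    then have "real_of_int (y1 ^ k) \<le> of_int (2 * (int b * int c))" "real_of_int (y2 ^ k) \<le> of_int (2 * (int b * int c))"
      "real_of_int (x1 ^ k) \<le> of_int (2 * (int b * int d))" "real_of_int (x2 ^ k) \<le> of_int (2 * (int b * int d))"
      "real_of_int (int a * int d) \<le> of_int (2 * x1 ^ k)" "real_of_int (int a * int d) \<le> of_int (2 * x2 ^ k)"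
      by (simp_all only: of_int_le_iff)
    then show "of_int y1 ^ k \<le> 2 * real b * real c" "of_int y2 ^ k \<le> 2 * real b * real c"
    "of_int x1 ^ k \<le> 2 * real b * real d" "of_int x2 ^ k \<le> 2 * real b * real d"
    "real a * real d / 2 \<le> of_int x1 ^ k" "real a * real d / 2 \<le> of_int x2 ^ k" by simp_all
  qed
  have w0: "0 < real a * real d / 2" using a0 ord by simp
  \<comment> \<open>Here \<open>s\<close> is the larger side of the Thue equation, with
    \<open>e = b\<close> for positive and \<open>e = a\<close> for negative \<open>n\<close>;
    \<open>2 * \<bar>n\<bar> \<le> a * c\<close> keeps it within a factor \<open>2\<close> of
    \<open>a * b * c\<close>.\<close>
  have Sb: "real a * real b * real c / 2 \<le> of_int s" "of_int s \<le> 2 * (real a * real b * real c)"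
    if "s = int a * (int b * int c) + n * int e" "e \<le> b" for s e
  proof -
    have "\<bar>n * int e\<bar> \<le> \<bar>n\<bar> * int b" unfolding abs_mult using that by (intro mult_left_mono) auto
    moreover have "2 * \<bar>n\<bar> * int b \<le> int a * int c * int b" using n by (intro mult_right_mono) auto
    ultimately have "int a * int b * int c \<le> 2 * s" "s \<le> 2 * (int a * int b * int c)"
      using that(1) by (auto simp: algebra_simps)
    then have "real_of_int (int a * int b * int c) \<le> of_int (2 * s)" "real_of_int s \<le> of_int (2 * (int a * int b * int c))"
      by (simp_all only: of_int_le_iff)
    then show "real a * real b * real c / 2 \<le> of_int s" "of_int s \<le> 2 * (real a * real b * real c)" by simp_all
  qed
  show ?thesis
  proof (cases "n > 0")
    case True
    have e: "int b * y1 ^ k = int a * y2 ^ k + D'" "int b * x1 ^ k = int a * x2 ^ k + D'"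
      unfolding y1(2)[symmetric] y2(2)[symmetric] x1(2)[symmetric] x2(2)[symmetric] D'_def N_def
      using True by (simp_all add: algebra_simps)
    have s: "int b * y1 ^ k = int a * (int b * int c) + n * int b"
      unfolding y1(2)[symmetric] by (simp add: algebra_simps)
    show ?thesis
    proof (rule that)
      show "real a * real b * real c / 2 \<le> of_int (int b * y1 ^ k)" "of_int (int b * y1 ^ k) \<le> 2 * (real a * real b * real c)"
        using Sb[OF s] by auto
    next
      fix M L
      assume "(real k)\<^sup>2 * D\<^sup>2 < of_int (int b * y1 ^ k)"
        "(4 * (real k)\<^sup>2 * of_int (int b * y1 ^ k)) ^ M * ((real k)\<^sup>2 * D\<^sup>2 / of_int (int b * y1 ^ k)) ^ L \<le> 1"
      then show "(real a * real d / 2) ^ (k - 1) \<le> (8 * (real k)\<^sup>2 * of_int (int b * y1 ^ k) * D) ^ k * (2 * real b * real c) \<or>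
      ((real a * real d / 2) ^ (k - 1)) ^ M \<le> ((2 * D) ^ M * (4 * (real k)\<^sup>2 * of_int (int b * y1 ^ k)) ^ (2 * M) * (2 * D / of_int (int b * y1 ^ k)) ^ L) ^ k
      * (2 * real b * real c) ^ (M + L) * (2 * real b * real d) ^ L"
        unfolding D' using y1 y2 x1 x2 a0 ord D0 w0 up
        by (intro thue_power_bound[OF k _ _ _ _ _ _ _ e]) auto
    qed
  next
    case False
    have e: "int a * y2 ^ k = int b * y1 ^ k + D'" "int a * x2 ^ k = int b * x1 ^ k + D'"
      unfolding y1(2)[symmetric] y2(2)[symmetric] x1(2)[symmetric] x2(2)[symmetric] D'_def N_def
      using False by (simp_all add: algebra_simps)
    have s: "int a * y2 ^ k = int a * (int b * int c) + n * int a"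
      unfolding y2(2)[symmetric] by (simp add: algebra_simps)
    show ?thesis
    proof (rule that)
      show "real a * real b * real c / 2 \<le> of_int (int a * y2 ^ k)" "of_int (int a * y2 ^ k) \<le> 2 * (real a * real b * real c)"
        using Sb[OF s] ord by auto
    next
      fix M L
      assume "(real k)\<^sup>2 * D\<^sup>2 < of_int (int a * y2 ^ k)"
        "(4 * (real k)\<^sup>2 * of_int (int a * y2 ^ k)) ^ M * ((real k)\<^sup>2 * D\<^sup>2 / of_int (int a * y2 ^ k)) ^ L \<le> 1"
      then show "(real a * real d / 2) ^ (k - 1) \<le> (8 * (real k)\<^sup>2 * of_int (int a * y2 ^ k) * D) ^ k * (2 * real b * real c) \<or>
      ((real a * real d / 2) ^ (k - 1)) ^ M \<le> ((2 * D) ^ M * (4 * (real k)\<^sup>2 * of_int (int a * y2 ^ k)) ^ (2 * M) * (2 * D / of_int (int a * y2 ^ k)) ^ L) ^ k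
      * (2 * real b * real c) ^ (M + L) * (2 * real b * real d) ^ L"
        unfolding D' using y1 y2 x1 x2 a0 ord D0 w0 up
        by (intro thue_power_bound[OF k _ _ _ _ _ _ _ e]) auto
    qed
  qed
qed

section \<open>Growth against the two alternatives of the Thue inequality\<close>

text \<open>In powers of \<open>T\<close> the left side has degree at least
  \<open>(k - 2) * (k - 1)\<close>, the right side stays below degree \<open>2 * k + 2\<close>. The
  two degrees agree at \<open>k = 5\<close>, which is the source of the bound on
  \<open>k\<close>.\<close>

lemma thue_linear_case_contradiction:
  fixes k :: nat and x b c d t T D :: real
  assumes k: "k \<ge> 5" and ord: "1 \<le> x" "x \<le> t" "0 < b" "b \<le> t" "0 < c" "c \<le> T" "0 \<le> D" "D \<le> t ^ 2"
    and T: "16 * (real k)\<^sup>2 * t ^ 4 \<le> T" "2 * t < T" and d: "T ^ (k - 2) \<le> d / 2"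
  shows "\<not> (x * d / 2) ^ (k - 1) \<le> (16 * (real k)\<^sup>2 * (x * b * c) * D) ^ k * (2 * b * c)"
proof
  assume *: "(x * d / 2) ^ (k - 1) \<le> (16 * (real k)\<^sup>2 * (x * b * c) * D) ^ k * (2 * b * c)"
  have T1: "T > 1" using T(2) ord by linarith
  have "d / 2 \<le> x * (d / 2)"
    using ord d T1 by (simp add: mult_le_cancel_right1) (smt (verit) zero_less_power)
  then have xd: "T ^ (k - 2) \<le> x * d / 2" using d by simp
  have "T ^ (2 * k + 2) \<le> T ^ ((k - 2) * (k - 1))"
  proof (rule power_increasing)
    obtain j where "k = j + 5" using k by (metis add.commute le_Suc_ex)
    then show "2 * k + 2 \<le> (k - 2) * (k - 1)" by (simp add: algebra_simps)
  qed (use T1 in simp)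
  also have "\<dots> = (T ^ (k - 2)) ^ (k - 1)" by (rule power_mult)
  also have "\<dots> \<le> (x * d / 2) ^ (k - 1)" using xd T1 by (intro power_mono) auto
  also note *
  also have "(16 * (real k)\<^sup>2 * (x * b * c) * D) ^ k * (2 * b * c) \<le> (T * T) ^ k * (2 * t * T)"
  proof -
    have "16 * (real k)\<^sup>2 * (x * b * c) * D \<le> 16 * (real k)\<^sup>2 * (t * t * T) * t ^ 2"
      using ord by (intro mult_mono mult_left_mono) auto
    also have "\<dots> = 16 * (real k)\<^sup>2 * t ^ 4 * T" by (simp add: power_numeral_reduce mult_ac)
    also have "\<dots> \<le> T * T" using T T1 by (intro mult_right_mono) auto
    finally have "(16 * (real k)\<^sup>2 * (x * b * c) * D) ^ k \<le> (T * T) ^ k"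
      using ord by (intro power_mono) auto
    moreover have "2 * b * c \<le> 2 * t * T" using ord by (intro mult_mono) auto
    ultimately show ?thesis using ord T1 by (intro mult_mono) auto
  qed
  also have "\<dots> < (T * T) ^ k * (T * T)"
    using T T1 by (intro mult_strict_left_mono mult_strict_right_mono) auto
  also have "\<dots> = T ^ (2 * k + 2)"
    by (simp add: power_mult_distrib power_add mult_2 power2_eq_square)
  finally show False by simp
qed

text \<open>The factor \<open>(d / 2)\<^sup>2\<close> cancels, leaving
  \<open>(d / 2) ^ (k - 3)\<close> on the left. The constant \<open>128\<close> with
  \<open>b ^ 5\<close> collects \<open>(2 * b) ^ 3\<close> and
  \<open>(4 * b)\<^sup>2\<close>.\<close>

lemma thue_quadratic_case_contradiction:
  fixes k :: nat and x b c d t T D :: real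
  assumes k: "k \<ge> 4" and ord: "1 \<le> x" "0 < b" "b \<le> t" "0 < c" "0 \<le> D" "1 \<le> T"
    and T: "(128 * real k ^ 4 * D ^ 3) ^ k * (128 * t ^ 5 * c ^ 3) < T ^ ((k - 2) * (k - 3))"
    and d: "T ^ (k - 2) \<le> d / 2"
  shows "\<not> (x * d / 2) ^ (k - 1) \<le> (128 * real k ^ 4 * D ^ 3) ^ k * (2 * b * c) ^ 3 * (2 * b * d)\<^sup>2"
proof
  assume *: "(x * d / 2) ^ (k - 1) \<le> (128 * real k ^ 4 * D ^ 3) ^ k * (2 * b * c) ^ 3 * (2 * b * d)\<^sup>2"
  define y where "y = d / 2"
  have y1: "1 \<le> y" unfolding y_def using d one_le_power[OF ord(6), of "k - 2"] by linarith
  have "k - 1 = (k - 3) + 2" using k by simp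
  then have "y ^ (k - 3) * y\<^sup>2 = y ^ (k - 1)" by (simp only: power_add)
  also have "\<dots> \<le> (x * d / 2) ^ (k - 1)"
    using ord y1 unfolding y_def by (intro power_mono) (auto simp: mult_le_cancel_right1)
  also note *
  also have "(128 * real k ^ 4 * D ^ 3) ^ k * (2 * b * c) ^ 3 * (2 * b * d)\<^sup>2
      = (128 * real k ^ 4 * D ^ 3) ^ k * (128 * b ^ 5 * c ^ 3) * y\<^sup>2"
    unfolding y_def by (simp add: power_mult_distrib power_divide power_numeral_reduce mult_ac)
  finally have "y ^ (k - 3) \<le> (128 * real k ^ 4 * D ^ 3) ^ k * (128 * b ^ 5 * c ^ 3)"
    by (rule mult_right_le_imp_le) (use y1 in simp)
  also have "\<dots> \<le> (128 * real k ^ 4 * D ^ 3) ^ k * (128 * t ^ 5 * c ^ 3)"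
    using ord by (intro mult_left_mono mult_right_mono power_mono) auto
  also note T
  also have "T ^ ((k - 2) * (k - 3)) = (T ^ (k - 2)) ^ (k - 3)" by (rule power_mult)
  also have "\<dots> \<le> y ^ (k - 3)" unfolding y_def using d ord by (intro power_mono) auto
  finally show False by simp
qed

section \<open>Chains of large elements\<close>

text \<open>The last assumption says that \<open>A 0 \<ge> \<bar>n\<bar>\<^sup>k\<^sup>/\<^sup>(\<^sup>k\<^sup>-\<^sup>2\<^sup>)\<close>; it holds trivially if \<open>\<bar>n\<bar> = 1\<close>. Under it the gap
  principle takes the form \<open>G (i + 1) \<ge> K (G i)\<^sup>k\<^sup>-\<^sup>1\<close> for the quantities \<open>G\<close> below.\<close>

locale diophantine_chain =
  fixes k p :: nat and n :: int and A :: "nat \<Rightarrow> nat"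
  assumes k: "k \<ge> 3" and n: "n \<noteq> 0" and p: "p \<ge> 4"
    and tuple: "diophantine_tuple k n (A ` {..<p})"
    and mono: "strict_mono_on {..<p} A"
    and large: "\<bar>n\<bar> ^ k \<le> int (A 0) ^ (k - 2)"
begin

abbreviation a :: "nat \<Rightarrow> real" where "a i \<equiv> real (A i)"
abbreviation N :: real where "N \<equiv> of_int \<bar>n\<bar>"

text \<open>Dividing by \<open>a 0\<close> absorbs \<open>N ^ k \<le> a 0 ^ (k - 2)\<close> and
  makes the gap principle a recursion without parameters.\<close>

definition G :: "nat \<Rightarrow> real" where "G i = a i * a (i + 2) / a 0"
text \<open>The denominator is the price for replacing \<open>a i * a (i + 2) - N\<close> by half of
  \<open>a i * a (i + 2)\<close>.\<close>

definition K :: real where "K = real k ^ k / 2 ^ (k - 1)"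

lemma A_less: "i < j \<Longrightarrow> j < p \<Longrightarrow> A i < A j"
  by (rule strict_mono_onD[OF mono]) auto

lemma A_in: "i < p \<Longrightarrow> A i \<in> A ` {..<p}"
  by simp

lemma A_ge_Suc: "i < p \<Longrightarrow> i + 1 \<le> A i"
proof (induction i)
  case 0
  then have "0 < A 0" using tuple A_in[of 0] unfolding diophantine_tuple_def by blast
  then show ?case by simp
next
  case (Suc i)
  then show ?case using A_less[of i "Suc i"] by simp
qed

lemma a_less: "i < j \<Longrightarrow> j < p \<Longrightarrow> a i < a j"
  using A_less by simp

lemma a_le: "i \<le> j \<Longrightarrow> j < p \<Longrightarrow> a i \<le> a j"
  using a_less[of i j] by (cases "i = j") auto

lemma a_ge_Suc: "i < p \<Longrightarrow> real i + 1 \<le> a i"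
  using A_ge_Suc[of i] by linarith

lemma a_pos: "i < p \<Longrightarrow> a i > 0"
  using a_ge_Suc[of i] by linarith

lemma N_ge_1: "N \<ge> 1"
proof -
  have "\<bar>n\<bar> \<ge> 1" using n by simp
  then show ?thesis by linarith
qed

lemma N_power_le: "N ^ k \<le> a 0 ^ (k - 2)"
proof -
  have "real_of_int (\<bar>n\<bar> ^ k) \<le> of_int (int (A 0) ^ (k - 2))"
    using large by (simp only: of_int_le_iff)
  then show ?thesis by simp
qed

lemma N_le: "N \<le> a 0"
proof (rule ccontr)
  assume "\<not> N \<le> a 0"
  then have *: "a 0 < N" by simp
  moreover have "1 \<le> a 0" using a_ge_Suc[of 0] p by simp
  ultimately have "a 0 ^ (k - 2) \<le> N ^ (k - 2)" "1 < N" by (intro power_mono, simp, simp, linarith)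
  moreover from this have "N ^ (k - 2) < N ^ k" using k by (intro power_strict_increasing) auto
  ultimately show False using N_power_le by linarith
qed

text \<open>One factor is at least \<open>N\<close> by \<open>N_le\<close>; the other one is at
  least \<open>2\<close>, having a positive index.\<close>

lemma two_n_le:
  assumes "0 < j" "i < p" "j < p"
  shows "2 * \<bar>n\<bar> \<le> int (A i) * int (A j)"
proof -
  have "N * 2 \<le> a i * a j"
    using N_le a_le[of 0 i] a_ge_Suc[of j] assms N_ge_1 by (intro mult_mono) auto
  then have "real_of_int (2 * \<bar>n\<bar>) \<le> of_int (int (A i) * int (A j))" by simp
  then show ?thesis by (simp only: of_int_le_iff)
qed

lemma gap:
  assumes "i < j" "j < l" "l < m" "m < p"
  shows "real k ^ k * (a i * a l - N) ^ (k - 1) \<le> N ^ k * (a j * a m)"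
proof (rule diophantine_gap[OF tuple])
  show "A i \<in> A ` {..<p}" "A j \<in> A ` {..<p}" "A l \<in> A ` {..<p}" "A m \<in> A ` {..<p}"
    using assms by (auto intro!: A_in)
  show "A i < A j" "A j < A l" "A l < A m" using assms by (auto intro!: A_less)
  show "\<bar>n\<bar> < int (A i) * int (A l)" using two_n_le[of l i] assms n by simp
qed (use n k in auto)

lemma K_pos: "K > 0"
  unfolding K_def using k by simp

lemma G_Suc:
  assumes "i + 3 < p"
  shows "K * G i ^ (k - 1) \<le> G (Suc i)"
proof -
  have pos: "a 0 > 0" "a i > 0" "a (i + 2) > 0" using a_pos assms by auto
  have "2 * N \<le> a i * a (i + 2)"
  proof -
    have "real_of_int (2 * \<bar>n\<bar>) \<le> of_int (int (A i) * int (A (i + 2)))"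
      using two_n_le[of "i + 2" i] assms by (simp only: of_int_le_iff)
    then show ?thesis by simp
  qed
  then have "(a i * a (i + 2) / 2) ^ (k - 1) \<le> (a i * a (i + 2) - N) ^ (k - 1)"
    using pos by (intro power_mono) auto
  then have "real k ^ k * (a i * a (i + 2) / 2) ^ (k - 1) \<le> real k ^ k * (a i * a (i + 2) - N) ^ (k - 1)"
    by (intro mult_left_mono) auto
  also have "\<dots> \<le> N ^ k * (a (i + 1) * a (i + 3))"
    using gap[of i "i + 1" "i + 2" "i + 3"] assms by simp
  also have "\<dots> \<le> a 0 ^ (k - 2) * (a (i + 1) * a (i + 3))"
    using N_power_le by (intro mult_right_mono) auto
  finally have *: "real k ^ k * (a i * a (i + 2) / 2) ^ (k - 1) \<le> a 0 ^ (k - 2) * (a (i + 1) * a (i + 3))" .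
  have "K * G i ^ (k - 1) = real k ^ k * (a i * a (i + 2) / 2) ^ (k - 1) / a 0 ^ (k - 1)"
    unfolding K_def G_def by (simp add: power_divide power_mult_distrib)
  also have "\<dots> \<le> a 0 ^ (k - 2) * (a (i + 1) * a (i + 3)) / a 0 ^ (k - 1)"
    using * pos by (intro divide_right_mono) auto
  also have "\<dots> = G (Suc i)"
  proof -
    have "k - 1 = Suc (k - 2)" using k by simp
    then show ?thesis unfolding G_def using pos by (simp add: numeral_3_eq_3)
  qed
  finally show ?thesis .
qed

lemma G_0: "G 0 = a 2"
  unfolding G_def using a_pos[of 0] p by (simp add: numeral_2_eq_2)

lemma G_ge: "i + 2 < p \<Longrightarrow> a (i + 2) \<le> G i"
  unfolding G_def using a_pos[of 0] a_le[of 0 i] p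
  by (simp add: pos_le_divide_eq mult.commute mult_right_mono)

lemma G_pos: "i + 2 < p \<Longrightarrow> 0 < G i"
  using G_ge[of i] a_pos[of "i + 2"] by linarith

text \<open>The quotient \<open>G (i + 2) / G i\<close> telescopes to
  \<open>a (i + 4) / a i\<close>. This transfers growth of \<open>G\<close> to the elements
  themselves, four indices at a time.\<close>

lemma G_chain:
  assumes "i + 4 < p"
  shows "a (i + 4) * G i = G (i + 2) * a i"
  using assms a_pos[of 0] unfolding G_def by (simp add: numeral_eq_Suc)

text \<open>The constant term of the Thue equation whose coefficients are the two smallest
  elements.\<close>

definition Df :: real where "Df = N * (a 1 - a 0)"

lemma D_bounds: "1 \<le> Df" "Df \<le> N * a 1"
proof -
  have "1 * 1 \<le> Df" unfolding Df_def using N_ge_1 A_less[of 0 1] p by (intro mult_mono) auto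
  then show "1 \<le> Df" by simp
  show "Df \<le> N * a 1" unfolding Df_def using N_ge_1 by (intro mult_left_mono) auto
qed

lemma D_power_le: "Df ^ k \<le> a 0 ^ (k - 2) * a 1 ^ k"
proof -
  have "Df ^ k \<le> (N * a 1) ^ k" using D_bounds by (intro power_mono) auto
  also have "\<dots> \<le> a 0 ^ (k - 2) * a 1 ^ k"
    unfolding power_mult_distrib using N_power_le by (intro mult_right_mono) auto
  finally show ?thesis .
qed

lemma thue:
  assumes "1 < l" "l < m" "m < p"
  obtains S :: real where "a 0 * a 1 * a l / 2 \<le> S" "S \<le> 2 * (a 0 * a 1 * a l)"
    "\<And>M L. (real k)\<^sup>2 * Df\<^sup>2 < S \<Longrightarrow> (4 * (real k)\<^sup>2 * S) ^ M * ((real k)\<^sup>2 * Df\<^sup>2 / S) ^ L \<le> 1 \<Longrightarrow>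
      (a 0 * a m / 2) ^ (k - 1) \<le> (8 * (real k)\<^sup>2 * S * Df) ^ k * (2 * a 1 * a l) \<or>
      ((a 0 * a m / 2) ^ (k - 1)) ^ M \<le> ((2 * Df) ^ M * (4 * (real k)\<^sup>2 * S) ^ (2 * M) * (2 * Df / S) ^ L) ^ k
      * (2 * a 1 * a l) ^ (M + L) * (2 * a 1 * a m) ^ L"
proof -
  have mem: "A 0 \<in> A ` {..<p}" "A 1 \<in> A ` {..<p}" "A l \<in> A ` {..<p}" "A m \<in> A ` {..<p}"
    using assms by simp_all
  have less: "A 0 < A 1" "A 1 < A l" "A l < A m"
    using A_less[of 0 1] A_less[of 1 l] A_less[of l m] assms by simp_all
  have "2 * \<bar>n\<bar> \<le> int (A 0) * int (A l)" "2 \<le> k"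
    using two_n_le[of l 0] assms k by simp_all
  note Thue = diophantine_thue[OF tuple mem less this(1) n this(2), folded Df_def]
  show ?thesis
  proof (rule Thue)
    fix S assume *: "a 0 * a 1 * a l / 2 \<le> S" "S \<le> 2 * (a 0 * a 1 * a l)"
      "\<And>M L. (real k)\<^sup>2 * Df\<^sup>2 < S \<Longrightarrow> (4 * (real k)\<^sup>2 * S) ^ M * ((real k)\<^sup>2 * Df\<^sup>2 / S) ^ L \<le> 1 \<Longrightarrow>
      (a 0 * a m / 2) ^ (k - 1) \<le> (8 * (real k)\<^sup>2 * S * Df) ^ k * (2 * a 1 * a l) \<or>
      ((a 0 * a m / 2) ^ (k - 1)) ^ M \<le> ((2 * Df) ^ M * (4 * (real k)\<^sup>2 * S) ^ (2 * M) * (2 * Df / S) ^ L) ^ k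
      * (2 * a 1 * a l) ^ (M + L) * (2 * a 1 * a m) ^ L"
    show thesis by (rule that[OF *])
  qed
qed

text \<open>The case \<open>M = 1\<close>, \<open>L = 2\<close>. The balance condition becomes
  \<open>4 * k ^ 6 * Df ^ 4 \<le> S\<close>, doubled in \<open>big\<close> because \<open>S\<close>
  may be half of \<open>a 0 * a 1 * a l\<close>. In the second alternative \<open>S\<close> cancels
  and leaves \<open>128 * k ^ 4 * Df ^ 3\<close>.\<close>

lemma thue_quadratic:
  assumes lm: "1 < l" "l < m" "m < p" and big: "8 * real k ^ 6 * Df ^ 4 \<le> a 0 * a 1 * a l"
  obtains "(a 0 * a m / 2) ^ (k - 1) \<le> (16 * (real k)\<^sup>2 * (a 0 * a 1 * a l) * Df) ^ k * (2 * a 1 * a l)"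
  | "(a 0 * a m / 2) ^ (k - 1) \<le> (128 * real k ^ 4 * Df ^ 3) ^ k * (2 * a 1 * a l) ^ 3 * (2 * a 1 * a m)\<^sup>2"
proof -
  obtain S where S: "a 0 * a 1 * a l / 2 \<le> S" "S \<le> 2 * (a 0 * a 1 * a l)"
    and T: "\<And>M L. (real k)\<^sup>2 * Df\<^sup>2 < S \<Longrightarrow> (4 * (real k)\<^sup>2 * S) ^ M * ((real k)\<^sup>2 * Df\<^sup>2 / S) ^ L \<le> 1 \<Longrightarrow>
      (a 0 * a m / 2) ^ (k - 1) \<le> (8 * (real k)\<^sup>2 * S * Df) ^ k * (2 * a 1 * a l) \<or>
      ((a 0 * a m / 2) ^ (k - 1)) ^ M \<le> ((2 * Df) ^ M * (4 * (real k)\<^sup>2 * S) ^ (2 * M) * (2 * Df / S) ^ L) ^ k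
      * (2 * a 1 * a l) ^ (M + L) * (2 * a 1 * a m) ^ L"
    using thue[OF lm] by blast
  have big': "4 * real k ^ 6 * Df ^ 4 \<le> S" using big S(1) by linarith
  have D1: "1 \<le> Df" by (rule D_bounds)
  have k1: "1 \<le> real k" using k by simp
  have S0: "S > 0" using big' D1 k1 by (meson less_le_trans mult_pos_pos zero_less_power zero_less_numeral zero_less_one)
  have less: "(real k)\<^sup>2 * Df\<^sup>2 < S"
  proof -
    have "(real k)\<^sup>2 * Df\<^sup>2 \<le> real k ^ 6 * Df ^ 4"
      using D1 k1 by (intro mult_mono power_increasing) auto
    moreover have "0 < real k ^ 6 * Df ^ 4" using D1 k1 by (intro mult_pos_pos zero_less_power) auto
    ultimately show ?thesis using big' by linarith
  qed
  have bal: "(4 * (real k)\<^sup>2 * S) ^ 1 * ((real k)\<^sup>2 * Df\<^sup>2 / S) ^ 2 \<le> 1"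
  proof -
    have "(4 * (real k)\<^sup>2 * S) ^ 1 * ((real k)\<^sup>2 * Df\<^sup>2 / S) ^ 2 = 4 * real k ^ 6 * Df ^ 4 / S"
      using S0 by (simp add: power_divide power_mult_distrib field_simps power_numeral_reduce)
    also have "\<dots> \<le> 1" using big' S0 by simp
    finally show ?thesis .
  qed
  have eq: "(2 * Df) ^ 1 * (4 * (real k)\<^sup>2 * S) ^ (2 * 1) * (2 * Df / S) ^ 2 = 128 * real k ^ 4 * Df ^ 3"
    using S0 by (simp add: power_divide power_mult_distrib field_simps power_numeral_reduce)
  have "(a 0 * a m / 2) ^ (k - 1) \<le> (8 * (real k)\<^sup>2 * S * Df) ^ k * (2 * a 1 * a l) \<or>
    (a 0 * a m / 2) ^ (k - 1) \<le> (128 * real k ^ 4 * Df ^ 3) ^ k * (2 * a 1 * a l) ^ (1 + 2) * (2 * a 1 * a m)\<^sup>2"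
    using T[OF less bal] unfolding eq by (simp only: power_one_right)
  then show ?thesis
  proof
    assume *: "(a 0 * a m / 2) ^ (k - 1) \<le> (8 * (real k)\<^sup>2 * S * Df) ^ k * (2 * a 1 * a l)"
    have "8 * (real k)\<^sup>2 * S * Df \<le> 8 * (real k)\<^sup>2 * (2 * (a 0 * a 1 * a l)) * Df"
      using S D1 by (intro mult_right_mono mult_left_mono) auto
    then have "(8 * (real k)\<^sup>2 * S * Df) ^ k * (2 * a 1 * a l)
        \<le> (16 * (real k)\<^sup>2 * (a 0 * a 1 * a l) * Df) ^ k * (2 * a 1 * a l)"
      using S0 D1 by (intro mult_right_mono power_mono) auto
    with * show ?thesis by (intro that(1)) linarith
  next
    assume "(a 0 * a m / 2) ^ (k - 1) \<le> (128 * real k ^ 4 * Df ^ 3) ^ k * (2 * a 1 * a l) ^ (1 + 2) * (2 * a 1 * a m)\<^sup>2"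
    moreover have "1 + 2 = (3 :: nat)" by simp
    ultimately show ?thesis by (intro that(2)) (simp only:)
  qed
qed

section \<open>Contradictions for long chains, by exponent\<close>

text \<open>For \<open>k = 3\<close> the choice \<open>M = 1\<close>, \<open>L = 2\<close> would put
  \<open>d\<^sup>2\<close> on both sides, so \<open>M = 2\<close>, \<open>L = 3\<close> is used,
  with solutions from \<open>a 5\<close> and \<open>a 9\<close>.\<close>

lemma no_chain_cubic:
  assumes k3: "k = 3" and p10: "p \<ge> 10"
  shows False
proof -
  define \<kappa> :: real where "\<kappa> = 27 / 4"
  have \<kappa>0: "\<kappa> > 0" unfolding \<kappa>_def by simp
  define x b t c d where "x = a 0" and "b = a 1" and "t = a 2" and "c = a 5" and "d = a 9"
  have ord: "1 \<le> x" "x < b" "b < t" "3 \<le> t" "t \<le> c"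
    unfolding x_def b_def t_def c_def
    using a_ge_Suc[of 0] a_less[of 0 1] a_less[of 1 2] a_ge_Suc[of 2] a_le[of 2 5] p10 by auto
  have step: "\<kappa> * G i ^ 2 \<le> G (Suc i)" if "i + 3 < p" for i
    using G_Suc[OF that] unfolding K_def \<kappa>_def by (simp add: k3)
  have step2: "\<kappa> ^ 3 * G i ^ 4 \<le> G (i + 2)" if "i + 4 < p" for i
  proof -
    have "\<kappa> ^ 3 * G i ^ 4 = \<kappa> * (\<kappa> * G i ^ 2) ^ 2"
      by (simp add: power_numeral_reduce mult_ac)
    also have "\<dots> \<le> \<kappa> * G (Suc i) ^ 2"
      using step[of i] that \<kappa>0 by (intro mult_left_mono power_mono) auto
    also have "\<dots> \<le> G (i + 2)" using step[of "Suc i"] that by simp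
    finally show ?thesis .
  qed
  have jump: "\<kappa> ^ 3 * G i ^ 3 * a i \<le> a (i + 4)" if "i + 4 < p" for i
  proof -
    have G0: "G i > 0" using G_pos[of i] that by simp
    have "(\<kappa> ^ 3 * G i ^ 3 * a i) * G i = \<kappa> ^ 3 * G i ^ 4 * a i"
      by (simp add: power_numeral_reduce mult_ac)
    also have "\<dots> \<le> G (i + 2) * a i" using step2[OF that] by (intro mult_right_mono) auto
    also have "\<dots> = a (i + 4) * G i" using G_chain[OF that] by simp
    finally show ?thesis using G0 by simp
  qed
  have c_low: "\<kappa> ^ 6 * t ^ 6 * b \<le> c"
  proof -
    have "\<kappa> * t ^ 2 \<le> G 1" using step[of 0] p10 unfolding G_0 t_def by simp
    then have "\<kappa> ^ 3 * (\<kappa> * t ^ 2) ^ 3 * b \<le> \<kappa> ^ 3 * G 1 ^ 3 * b"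
      using ord \<kappa>0 by (intro mult_right_mono mult_left_mono power_mono) auto
    also have "\<dots> \<le> c" using jump[of 1] p10 unfolding b_def c_def by simp
    finally show ?thesis by (simp add: power_mult_distrib)
  qed
  have d_low: "\<kappa> ^ 12 * c ^ 13 \<le> d"
  proof -
    have "c \<le> G 3" using G_ge[of 3] p10 unfolding c_def by simp
    then have "\<kappa> ^ 3 * c ^ 4 \<le> \<kappa> ^ 3 * G 3 ^ 4"
      using ord \<kappa>0 by (intro mult_left_mono power_mono) auto
    also have "\<dots> \<le> G 5" using step2[of 3] p10 by simp
    finally have "\<kappa> ^ 3 * (\<kappa> ^ 3 * c ^ 4) ^ 3 * c \<le> \<kappa> ^ 3 * G 5 ^ 3 * c"
      using ord \<kappa>0 by (intro mult_right_mono mult_left_mono power_mono) auto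
    also have "\<dots> \<le> d" using jump[of 5] p10 unfolding c_def d_def by simp
    finally show ?thesis by (simp add: power_mult_distrib power_numeral_reduce mult_ac)
  qed
  have D1: "1 \<le> Df" by (rule D_bounds)
  have N3: "N ^ 3 \<le> x" using N_power_le unfolding x_def by (simp add: k3)
  have D3: "Df ^ 3 \<le> x * b ^ 3" using D_power_le unfolding x_def b_def by (simp add: k3)
  \<comment> \<open>The balance condition is \<open>36 ^ 2 * 9 ^ 3 * Df ^ 6 \<le> S\<close>;
    \<open>1889568\<close> is twice that coefficient.\<close>
  have D6: "1889568 * Df ^ 6 \<le> x * b * c"
  proof -
    define e where "e = b - x"
    have e: "0 < e" "e \<le> t" using ord unfolding e_def by auto
    have "Df ^ 6 = (N ^ 3) ^ 2 * e ^ 6"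
      unfolding Df_def e_def x_def b_def by (simp add: power_mult_distrib)
    also have "\<dots> \<le> x ^ 2 * e ^ 6"
      using N3 N_ge_1 by (intro mult_right_mono power_mono) auto
    finally have 1: "1889568 * Df ^ 6 \<le> 1889568 * (x ^ 2 * e ^ 6)" by simp
    \<comment> \<open>For fixed \<open>b\<close>, the product \<open>x * (b - x)\<^sup>2\<close> is
      largest at \<open>b = 3 * x\<close>; the factorisation makes this bound explicit.\<close>
    have "4 * b ^ 3 - 27 * x * e ^ 2 = (2 * x - e) ^ 2 * (x + 4 * e)"
      unfolding e_def by (simp add: power2_eq_square power3_eq_cube algebra_simps)
    also have "\<dots> \<ge> 0" using ord e by (intro mult_nonneg_nonneg) auto
    finally have xe: "27 * (x * e ^ 2) \<le> 4 * b ^ 3" by simp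
    \<comment> \<open>The factor \<open>20\<close> is what is needed for
      \<open>20 * \<kappa> ^ 6 \<ge> 1889568\<close>; it is affordable because
      \<open>80 / 27 \<le> 3 \<le> t\<close>.\<close>
    have "20 * x * e ^ 6 = 20 / 27 * (27 * (x * e ^ 2)) * e ^ 4" by (simp add: power_numeral_reduce mult_ac)
    also have "\<dots> \<le> 20 / 27 * (4 * b ^ 3) * e ^ 4" using xe by (intro mult_right_mono mult_left_mono) auto
    also have "\<dots> \<le> b ^ 2 * (3 * b * e ^ 4)"
      using ord e by (simp add: power_numeral_reduce mult_ac)
    also have "3 * b * e ^ 4 \<le> t * t * t ^ 4"
      using ord e by (intro mult_mono power_mono) auto
    finally have 2: "20 * x * e ^ 6 \<le> b ^ 2 * t ^ 6" using ord by (simp add: power_numeral_reduce mult_ac)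
    have "1889568 * (x ^ 2 * e ^ 6) \<le> x * (\<kappa> ^ 6 * (20 * x * e ^ 6))"
      using ord e unfolding \<kappa>_def by (simp add: power2_eq_square power_divide)
    also have "\<dots> \<le> x * (\<kappa> ^ 6 * (b ^ 2 * t ^ 6))"
      using 2 ord \<kappa>0 by (intro mult_left_mono) auto
    also have "\<dots> = x * b * (\<kappa> ^ 6 * t ^ 6 * b)" by (simp add: power2_eq_square)
    also have "\<dots> \<le> x * b * c" using c_low ord by (intro mult_left_mono) auto
    finally show ?thesis using 1 by linarith
  qed
  have lm: "(1::nat) < 5" "(5::nat) < 9" "9 < p" using p10 by auto
  obtain S where S: "x * b * c / 2 \<le> S" "S \<le> 2 * (x * b * c)"
    and T: "\<And>M L. (real k)\<^sup>2 * Df\<^sup>2 < S \<Longrightarrow> (4 * (real k)\<^sup>2 * S) ^ M * ((real k)\<^sup>2 * Df\<^sup>2 / S) ^ L \<le> 1 \<Longrightarrow>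
      (x * d / 2) ^ (k - 1) \<le> (8 * (real k)\<^sup>2 * S * Df) ^ k * (2 * b * c) \<or>
      ((x * d / 2) ^ (k - 1)) ^ M \<le> ((2 * Df) ^ M * (4 * (real k)\<^sup>2 * S) ^ (2 * M) * (2 * Df / S) ^ L) ^ k
      * (2 * b * c) ^ (M + L) * (2 * b * d) ^ L"
    using thue[OF lm, folded x_def b_def c_def d_def] by blast
  have SD: "944784 * Df ^ 6 \<le> S" using D6 S by linarith
  have D_le: "Df ^ 2 \<le> Df ^ 6" "Df \<le> Df ^ 6" "1 \<le> Df ^ 6"
    using D1 power_increasing[of 2 6 Df] power_increasing[of 1 6 Df] by auto
  have S0: "S > 0" using SD D_le by linarith
  have "(real k)\<^sup>2 * Df\<^sup>2 < S" using SD D_le unfolding k3 by simp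
  moreover have "(4 * (real k)\<^sup>2 * S) ^ 2 * ((real k)\<^sup>2 * Df\<^sup>2 / S) ^ 3 \<le> 1"
  proof -
    have "(4 * (real k)\<^sup>2 * S) ^ 2 * ((real k)\<^sup>2 * Df\<^sup>2 / S) ^ 3 = 944784 * Df ^ 6 / S"
      using S0 unfolding k3 by (simp add: power_divide power_mult_distrib field_simps power_numeral_reduce mult_ac)
    then show ?thesis using SD S0 by simp
  qed
  ultimately consider "(x * d / 2) ^ 2 \<le> (72 * S * Df) ^ 3 * (2 * b * c)"
    | "(x * d / 2) ^ 4 \<le> ((2 * Df) ^ 2 * (36 * S) ^ 4 * (2 * Df / S) ^ 3) ^ 3 * (2 * b * c) ^ 5 * (2 * b * d) ^ 3"
    using T[of 2 3] unfolding k3 by (auto simp: power_mult[symmetric])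
  then show False
  proof cases
    case 1
    have "x * b * c \<le> c * c * c" using ord by (intro mult_mono) auto
    then have Sc: "S \<le> 2 * c ^ 3" using S by (simp add: power3_eq_cube)
    have Dc: "Df \<le> 2 * c ^ 3" using D_le SD Sc by linarith
    have "d \<ge> 0" unfolding d_def by simp
    then have "d / 2 \<le> x * d / 2" using ord by (simp add: mult_le_cancel_right1)
    \<comment> \<open>Degree \<open>26\<close> in \<open>c\<close> meets degree \<open>20\<close>,
      and the constants also favour the left side.\<close>
    have "(\<kappa> ^ 12 * c ^ 13 / 2) ^ 2 \<le> (x * d / 2) ^ 2"
      using d_low \<open>d / 2 \<le> x * d / 2\<close> ord \<kappa>0 by (intro power_mono) auto
    also have "\<dots> \<le> (72 * S * Df) ^ 3 * (2 * b * c)" by (rule 1)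
    also have "\<dots> \<le> (72 * (2 * c ^ 3) * (2 * c ^ 3)) ^ 3 * (2 * c * c)"
      using ord Sc Dc D1 S0 by (intro mult_mono power_mono) auto
    finally have "\<kappa> ^ 24 / 4 * c ^ 26 \<le> 47775744 * c ^ 20"
      by (simp add: power_mult_distrib power_divide power_mult[symmetric] power_add[symmetric] power_numeral_reduce mult_ac)
    also have "\<dots> \<le> 47775744 * c ^ 26" using ord by (intro mult_left_mono power_increasing) auto
    finally have "\<kappa> ^ 24 / 4 \<le> 47775744" by (rule mult_right_le_imp_le) (use ord in simp)
    then show False unfolding \<kappa>_def by (simp add: power_divide)
  next
    case 2
    have d0: "d > 0" unfolding d_def using a_pos[of 9] p10 by simp
    have eq: "(2 * Df) ^ 2 * (36 * S) ^ 4 * (2 * Df / S) ^ 3 = 53747712 * Df ^ 5 * S"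
      using S0 by (simp add: power_divide power_mult_distrib field_simps power_numeral_reduce mult_ac)
    have "((2 * Df) ^ 2 * (36 * S) ^ 4 * (2 * Df / S) ^ 3) ^ 3 = 53747712 ^ 3 * (Df ^ 3) ^ 5 * S ^ 3"
      unfolding eq by (simp add: power_mult_distrib)
    also have "\<dots> \<le> 53747712 ^ 3 * (x * b ^ 3) ^ 5 * (2 * (x * b * c)) ^ 3"
      using D3 S S0 D1 ord by (intro mult_mono power_mono) auto
    finally have "((2 * Df) ^ 2 * (36 * S) ^ 4 * (2 * Df / S) ^ 3) ^ 3 * ((2 * b * c) ^ 5 * (2 * b * d) ^ 3)
      \<le> 53747712 ^ 3 * (x * b ^ 3) ^ 5 * (2 * (x * b * c)) ^ 3 * ((2 * b * c) ^ 5 * (2 * b * d) ^ 3)"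
      using ord d0 by (intro mult_right_mono) auto
    then have "(x * d / 2) ^ 4 \<le> 53747712 ^ 3 * (x * b ^ 3) ^ 5 * (2 * (x * b * c)) ^ 3 * ((2 * b * c) ^ 5 * (2 * b * d) ^ 3)"
      using 2 by (simp only: mult.assoc)
    then have "d * (x ^ 4 * d ^ 3) \<le> (32768 * 53747712 ^ 3 * x ^ 4 * b ^ 26 * c ^ 8) * (x ^ 4 * d ^ 3)"
      by (simp add: power_mult_distrib power_divide power_mult[symmetric] power_numeral_reduce mult_ac)
    then have "d \<le> 32768 * 53747712 ^ 3 * x ^ 4 * b ^ 26 * c ^ 8"
      by (rule mult_right_le_imp_le) (use ord d0 in simp)
    also have "\<dots> \<le> 32768 * 53747712 ^ 3 * t ^ 4 * t ^ 26 * c ^ 8"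
      using ord by (intro mult_mono power_mono) auto
    also have "\<dots> = 32768 * 53747712 ^ 3 * (t ^ (4 + 26) * c ^ 8)" by (simp only: power_add mult.assoc)
    finally have up: "d \<le> 32768 * 53747712 ^ 3 * (t ^ 30 * c ^ 8)" by simp
    have "\<kappa> ^ 6 * t ^ 6 \<le> c"
    proof -
      have "\<kappa> ^ 6 * t ^ 6 * 1 \<le> \<kappa> ^ 6 * t ^ 6 * b" using ord \<kappa>0 by (intro mult_left_mono) auto
      then show ?thesis using c_low by simp
    qed
    \<comment> \<open>Splitting \<open>c ^ 13\<close> as \<open>c ^ 8 * c ^ 5\<close> and using
      \<open>c_low\<close> on the second factor reproduces exactly \<open>t ^ 30 * c ^ 8\<close>, so
      only the constants remain to be compared.\<close>
    then have "(\<kappa> ^ 6 * t ^ 6) ^ 5 \<le> c ^ 5" using ord \<kappa>0 by (intro power_mono) auto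
    then have "\<kappa> ^ 12 * (c ^ 8 * (\<kappa> ^ 6 * t ^ 6) ^ 5) \<le> \<kappa> ^ 12 * (c ^ 8 * c ^ 5)"
      using ord \<kappa>0 by (intro mult_left_mono) auto
    also have "\<dots> \<le> d" using d_low by (simp add: power_add[symmetric])
    finally have "\<kappa> ^ 12 * (c ^ 8 * (\<kappa> ^ 6 * t ^ 6) ^ 5) \<le> 32768 * 53747712 ^ 3 * (t ^ 30 * c ^ 8)"
      using up by linarith
    moreover have "\<kappa> ^ 12 * (c ^ 8 * (\<kappa> ^ 6 * t ^ 6) ^ 5) = \<kappa> ^ (12 + 30) * (t ^ 30 * c ^ 8)"
      unfolding power_add by (simp add: power_mult_distrib power_mult[symmetric] mult_ac)
    ultimately have "\<kappa> ^ 42 * (t ^ 30 * c ^ 8) \<le> 32768 * 53747712 ^ 3 * (t ^ 30 * c ^ 8)" by simp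
    then have "\<kappa> ^ 42 \<le> (32768 * 53747712 ^ 3 :: real)"
      by (rule mult_right_le_imp_le) (use ord in simp)
    then show False unfolding \<kappa>_def by (simp add: power_divide)
  qed
qed

text \<open>Here \<open>K = 32\<close> and the solutions come from \<open>a 4\<close> and
  \<open>a 6\<close>. The exact bound \<open>Df ^ 4 \<le> x ^ 2 * b ^ 4\<close> is used, as the
  general degree count for the linear alternative starts only at \<open>k = 5\<close>.\<close>

lemma no_chain_quartic:
  assumes k4: "k = 4" and p7: "p \<ge> 7"
  shows False
proof -
  define x b t c d where "x = a 0" and "b = a 1" and "t = a 2" and "c = a 4" and "d = a 6"
  have ord: "1 \<le> x" "x < b" "b < t" "t \<le> c"
    unfolding x_def b_def t_def c_def
    using a_ge_Suc[of 0] a_less[of 0 1] a_less[of 1 2] a_le[of 2 4] p7 by auto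
  have d0: "d > 0" unfolding d_def using a_pos[of 6] p7 by simp
  have step: "32 * G i ^ 3 \<le> G (Suc i)" if "i + 3 < p" for i
    using G_Suc[OF that] unfolding K_def by (simp add: k4)
  have step2: "2 ^ 20 * G i ^ 9 \<le> G (i + 2)" if "i + 4 < p" for i
  proof -
    have "2 ^ 20 * G i ^ 9 = 32 * (32 * G i ^ 3) ^ 3" by (simp add: power_mult_distrib)
    also have "\<dots> \<le> 32 * G (Suc i) ^ 3"
      using step[of i] that G_pos[of i] by (intro mult_left_mono power_mono) auto
    also have "\<dots> \<le> G (i + 2)" using step[of "Suc i"] that by simp
    finally show ?thesis .
  qed
  have jump: "2 ^ 20 * G i ^ 8 * a i \<le> a (i + 4)" if "i + 4 < p" for i
  proof -
    have G0: "G i > 0" using G_pos[of i] that by simp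
    have "(2 ^ 20 * G i ^ 8 * a i) * G i = 2 ^ 20 * G i ^ 9 * a i"
      by (simp add: power_numeral_reduce mult_ac)
    also have "\<dots> \<le> G (i + 2) * a i" using step2[OF that] by (intro mult_right_mono) auto
    also have "\<dots> = a (i + 4) * G i" using G_chain[OF that] by simp
    finally show ?thesis using G0 by simp
  qed
  have c_low: "2 ^ 20 * t ^ 8 * x \<le> c"
    using jump[of 0] p7 unfolding G_0 t_def x_def c_def by simp
  have G2: "2 ^ 20 * t ^ 9 \<le> G 2" "c \<le> G 2"
    using step2[of 0] G_ge[of 2] p7 unfolding G_0 t_def c_def by (simp_all add: numeral_eq_Suc)
  have d_low: "2 ^ 20 * G 2 ^ 8 \<le> d"
  proof -
    have "2 ^ 20 * G 2 ^ 8 * 1 \<le> 2 ^ 20 * G 2 ^ 8 * t" using ord by (intro mult_left_mono) auto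
    also have "\<dots> \<le> d" using jump[of 2] p7 unfolding t_def d_def by simp
    finally show ?thesis by simp
  qed
  have D1: "1 \<le> Df" by (rule D_bounds)
  have D4: "Df ^ 4 \<le> x ^ 2 * b ^ 4" using D_power_le unfolding x_def b_def by (simp add: k4)
  have big: "8 * real k ^ 6 * Df ^ 4 \<le> a 0 * a 1 * a 4"
  proof -
    have "8 * real k ^ 6 * Df ^ 4 \<le> 2 ^ 20 * (x ^ 2 * (b * b ^ 3))"
    proof -
      have "Df ^ 4 \<le> x ^ 2 * (b * b ^ 3)" using D4 by (simp add: power_numeral_reduce mult_ac)
      then have "32768 * Df ^ 4 \<le> 2 ^ 20 * (x ^ 2 * (b * b ^ 3))" by (intro mult_mono) auto
      moreover have "8 * real k ^ 6 = 32768" by (simp add: k4)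
      ultimately show ?thesis by (simp only:)
    qed
    also have "\<dots> \<le> 2 ^ 20 * (x ^ 2 * (b * t ^ 8))"
    proof -
      have "b ^ 3 \<le> t ^ 3" using ord by (intro power_mono) auto
      also have "\<dots> \<le> t ^ 8" using ord by (intro power_increasing) auto
      finally show ?thesis using ord by (intro mult_left_mono) auto
    qed
    also have "\<dots> = x * b * (2 ^ 20 * t ^ 8 * x)" by (simp add: power2_eq_square)
    also have "\<dots> \<le> x * b * c" using c_low ord by (intro mult_left_mono) auto
    finally show ?thesis unfolding x_def b_def c_def .
  qed
  have km: "k - 1 = 3" using k4 by simp
  have lm: "(1::nat) < 4" "(4::nat) < 6" "6 < p" using p7 by auto
  show False
  proof (rule thue_quadratic[OF lm big])
    assume "(a 0 * a 6 / 2) ^ (k - 1) \<le> (16 * (real k)\<^sup>2 * (a 0 * a 1 * a 4) * Df) ^ k * (2 * a 1 * a 4)"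
    then have "(x * d / 2) ^ 3 \<le> (256 * (x * b * c) * Df) ^ 4 * (2 * b * c)"
      unfolding km unfolding x_def b_def c_def d_def by (simp add: k4)
    also have "\<dots> = (256 * (x * b * c)) ^ 4 * Df ^ 4 * (2 * b * c)"
      by (simp only: power_mult_distrib)
    also have "\<dots> \<le> (256 * (x * b * c)) ^ 4 * (x ^ 2 * b ^ 4) * (2 * b * c)"
      using D4 ord by (intro mult_right_mono mult_left_mono) auto
    finally have "d ^ 3 * x ^ 3 \<le> (2 ^ 36 * x ^ 3 * b ^ 9 * c ^ 5) * x ^ 3"
      by (simp add: power_mult_distrib power_divide power_numeral_reduce mult_ac)
    then have "d ^ 3 \<le> 2 ^ 36 * x ^ 3 * b ^ 9 * c ^ 5"
      by (rule mult_right_le_imp_le) (use ord in simp)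
    also have "\<dots> \<le> 2 ^ 36 * c ^ 3 * c ^ 9 * c ^ 5"
      using ord by (intro mult_mono power_mono) auto
    also have "\<dots> = 2 ^ 36 * c ^ 17" by (simp add: power_add[symmetric])
    also have "\<dots> \<le> 2 ^ 36 * c ^ 24" using ord by (intro mult_left_mono power_increasing) auto
    finally have "d ^ 3 \<le> 2 ^ 36 * c ^ 24" .
    moreover have "(2 ^ 20 * c ^ 8) ^ 3 \<le> d ^ 3"
    proof (intro power_mono)
      have "2 ^ 20 * c ^ 8 \<le> 2 ^ 20 * G 2 ^ 8" using G2 ord by (intro mult_left_mono power_mono) auto
      then show "2 ^ 20 * c ^ 8 \<le> d" using d_low by linarith
    qed (use ord in auto)
    ultimately have "(2 ^ 20 * c ^ 8) ^ 3 \<le> 2 ^ 36 * c ^ 24" by linarith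
    then have "2 ^ 60 * c ^ 24 \<le> 2 ^ 36 * c ^ 24" by (simp add: power_mult_distrib)
    then have "2 ^ 60 \<le> (2 ^ 36 :: real)" by (rule mult_right_le_imp_le) (use ord in simp)
    then show False by simp
  next
    assume "(a 0 * a 6 / 2) ^ (k - 1) \<le> (128 * real k ^ 4 * Df ^ 3) ^ k * (2 * a 1 * a 4) ^ 3 * (2 * a 1 * a 6)\<^sup>2"
    then have "(x * d / 2) ^ 3 \<le> (2 ^ 15 * Df ^ 3) ^ 4 * (2 * b * c) ^ 3 * (2 * b * d)\<^sup>2"
      unfolding km unfolding x_def b_def c_def d_def by (simp add: k4)
    also have "\<dots> = 2 ^ 60 * (Df ^ 4) ^ 3 * (2 * b * c) ^ 3 * (2 * b * d)\<^sup>2"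
      by (simp add: power_mult_distrib power_mult[symmetric])
    also have "\<dots> \<le> 2 ^ 60 * (x ^ 2 * b ^ 4) ^ 3 * (2 * b * c) ^ 3 * (2 * b * d)\<^sup>2"
      using D4 ord D1 d0 by (intro mult_right_mono mult_left_mono power_mono) auto
    finally have "d * (x ^ 3 * d\<^sup>2) \<le> (2 ^ 68 * x ^ 3 * b ^ 17 * c ^ 3) * (x ^ 3 * d\<^sup>2)"
      by (simp add: power_mult_distrib power_divide power_mult[symmetric] power_numeral_reduce mult_ac)
    then have "d \<le> 2 ^ 68 * x ^ 3 * b ^ 17 * c ^ 3"
      by (rule mult_right_le_imp_le) (use ord d0 in simp)
    also have "\<dots> \<le> 2 ^ 68 * t ^ 3 * t ^ 17 * c ^ 3"
      using ord by (intro mult_mono power_mono) auto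
    also have "\<dots> = 2 ^ 68 * t ^ 20 * c ^ 3" by (simp add: power_add[symmetric])
    also have "\<dots> \<le> 2 ^ 68 * t ^ 45 * c ^ 3"
      using ord by (intro mult_right_mono mult_left_mono power_increasing) auto
    finally have up: "d \<le> 2 ^ 68 * t ^ 45 * c ^ 3" .
    \<comment> \<open>Of the eight factors \<open>G 2\<close> in \<open>d_low\<close>, five are
      bounded below through \<open>t\<close> and three through \<open>c\<close>, to match
      \<open>up\<close>.\<close>
    have "2 ^ 20 * ((2 ^ 20 * t ^ 9) ^ 5 * c ^ 3) \<le> 2 ^ 20 * (G 2 ^ 5 * G 2 ^ 3)"
      using G2 ord by (intro mult_left_mono mult_mono power_mono) auto
    also have "\<dots> \<le> d" using d_low by (simp add: power_add[symmetric])
    finally have "2 ^ 20 * ((2 ^ 20 * t ^ 9) ^ 5 * c ^ 3) \<le> 2 ^ 68 * t ^ 45 * c ^ 3"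
      using up by linarith
    then have "2 ^ 120 * (t ^ 45 * c ^ 3) \<le> 2 ^ 68 * (t ^ 45 * c ^ 3)"
      by (simp add: power_mult_distrib power_mult[symmetric] mult_ac)
    then have "2 ^ 120 \<le> (2 ^ 68 :: real)" by (rule mult_right_le_imp_le) (use ord in simp)
    then show False by simp
  qed
qed

text \<open>The solutions come from the consecutive elements \<open>a 4\<close> and
  \<open>a 5\<close>. \<open>T = G 2\<close> serves as a common scale: it bounds \<open>c\<close>
  from above, a power of \<open>t\<close> from above, and forces \<open>d\<close> to be at least
  \<open>K * T ^ (k - 2)\<close>.\<close>

lemma no_chain_six:
  assumes k5: "k \<ge> 5" and p6: "p \<ge> 6"
  shows False
proof -
  define x b t c d T where "x = a 0" and "b = a 1" and "t = a 2" and "c = a 4" and "d = a 5" and "T = G 2"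
  have ord: "1 \<le> x" "x < b" "b < t" "t \<le> c"
    unfolding x_def b_def t_def c_def
    using a_ge_Suc[of 0] a_less[of 0 1] a_less[of 1 2] a_le[of 2 4] p6 by auto
  \<comment> \<open>The constant \<open>512\<close> is \<open>4 * 128\<close>: the
    \<open>128\<close> comes from \<open>thue_quadratic\<close>, and the spare \<open>4 ^ k\<close>
    later absorbs the other factor \<open>128\<close>.\<close>
  have K3: "512 * real k ^ 4 \<le> K ^ 3"
  proof -
    have r: "5 \<le> real k" using k5 by simp
    have "K = 2 * (real k / 2) ^ k"
    proof -
      obtain j where "k = Suc j" using k5 by (cases k) auto
      then show ?thesis unfolding K_def by (simp add: power_divide)
    qed
    moreover have "(real k / 2) ^ 5 \<le> (real k / 2) ^ k"
      using k5 r by (intro power_increasing) auto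
    ultimately have "(2 * (real k / 2) ^ 5) ^ 3 \<le> K ^ 3" by (intro power_mono) auto
    moreover have "(2 * (real k / 2) ^ 5) ^ 3 = real k ^ 4 * real k ^ 11 / 4096"
      by (simp add: power_mult_distrib power_divide power_mult[symmetric] power_add[symmetric])
    moreover have "5 ^ 11 \<le> real k ^ 11" using r by (intro power_mono) auto
    then have "real k ^ 4 * (512 * 4096) \<le> real k ^ 4 * real k ^ 11"
      by (intro mult_left_mono) auto
    ultimately show ?thesis by simp
  qed
  have k1: "5 \<le> real k" using k5 by simp
  have Kk: "real k \<le> K"
  proof -
    have "real k ^ 3 \<le> real k ^ 4" "0 \<le> real k ^ 4" using k1 by (auto intro: power_increasing)
    then have "real k ^ 3 \<le> K ^ 3" using K3 by linarith
    then show ?thesis using K_pos by (simp add: power_mono_iff)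
  qed
  have T_low: "K ^ k * t ^ ((k - 1) * (k - 1)) \<le> T"
  proof -
    have "K * t ^ (k - 1) \<le> G 1" using G_Suc[of 0] p6 unfolding G_0 t_def by simp
    then have "K * (K * t ^ (k - 1)) ^ (k - 1) \<le> K * G 1 ^ (k - 1)"
      using K_pos ord by (intro mult_left_mono power_mono) auto
    also have "\<dots> \<le> T" using G_Suc[of 1] p6 unfolding T_def by (simp add: numeral_2_eq_2)
    also have "K * (K * t ^ (k - 1)) ^ (k - 1) = K ^ k * t ^ ((k - 1) * (k - 1))"
    proof -
      obtain j where "k = Suc j" using k5 by (cases k) auto
      then show ?thesis by (simp add: power_mult_distrib power_mult[symmetric])
    qed
    finally show ?thesis .
  qed
  have cT: "c \<le> T" using G_ge[of 2] p6 unfolding c_def T_def by simp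
  have T0: "T > 0" using cT ord by linarith
  have d_low: "K * T ^ (k - 2) \<le> d"
  proof -
    have a3: "a 3 \<le> T" "a 3 > 0" using a_le[of 3 4] a_pos[of 3] p6 cT unfolding c_def by auto
    have "(K * T ^ (k - 2)) * T = K * T ^ (k - 1)"
      using k5 by (simp add: power_Suc2[symmetric] Suc_diff_Suc numeral_2_eq_2)
    also have "\<dots> \<le> G 3" using G_Suc[of 2] p6 unfolding T_def by (simp add: numeral_3_eq_3)
    also have "\<dots> = a 3 * d / x" unfolding G_def d_def x_def by simp
    also have "\<dots> \<le> a 3 * d / 1" using ord unfolding d_def by (intro divide_left_mono) auto
    also have "\<dots> = a 3 * d" by simp
    also have "\<dots> \<le> T * d" using a3 unfolding d_def by (intro mult_right_mono) auto
    finally show ?thesis using T0 by (simp add: mult.commute)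
  qed
  have d_half: "T ^ (k - 2) \<le> d / 2"
  proof -
    have "2 * T ^ (k - 2) \<le> K * T ^ (k - 2)" using Kk k1 T0 by (intro mult_right_mono) auto
    then show ?thesis using d_low by linarith
  qed
  have D1: "1 \<le> Df" by (rule D_bounds)
  have Dt: "Df \<le> t ^ 2"
  proof -
    have "Df \<le> N * b" using D_bounds unfolding b_def by simp
    also have "\<dots> \<le> t * t" using N_le N_ge_1 ord unfolding x_def[symmetric] by (intro mult_mono) auto
    finally show ?thesis by (simp add: power2_eq_square)
  qed
  have K1: "1 \<le> K" using Kk k1 by linarith
  have t1: "1 \<le> t" using ord by linarith
  have sq16: "16 \<le> (k - 1) * (k - 1)" using k5 mult_le_mono[of 4 "k - 1" 4 "k - 1"] by simp
  have T_low': "K ^ 5 * t ^ 16 \<le> T"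
  proof -
    have "K ^ 5 * t ^ 16 \<le> K ^ k * t ^ ((k - 1) * (k - 1))"
      using K1 t1 k5 sq16 by (intro mult_mono power_increasing) auto
    then show ?thesis using T_low by linarith
  qed
  have big: "8 * real k ^ 6 * Df ^ 4 \<le> a 0 * a 1 * a 4"
  proof -
    have "8 * real k ^ 6 * Df ^ 4 \<le> 8 * real k ^ 6 * (t ^ 2) ^ 4"
      using Dt D1 by (intro mult_left_mono power_mono) auto
    also have "\<dots> \<le> (512 * real k ^ 4 * (real k) ^ 2) * t ^ 15"
    proof -
      have "(t ^ 2) ^ 4 \<le> t ^ 15" unfolding power_mult[symmetric] using t1 by (intro power_increasing) auto
      then have "8 * real k ^ 6 * (t ^ 2) ^ 4 \<le> 512 * real k ^ 6 * t ^ 15" by (intro mult_mono) auto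
      then show ?thesis by (simp add: power_numeral_reduce mult_ac)
    qed
    also have "\<dots> \<le> (K ^ 3 * K ^ 2) * t ^ 15"
      using K3 Kk t1 by (intro mult_right_mono mult_mono power_mono) auto
    finally have "(8 * real k ^ 6 * Df ^ 4) * t \<le> ((K ^ 3 * K ^ 2) * t ^ 15) * t"
      using t1 by (intro mult_right_mono) auto
    also have "\<dots> = K ^ 5 * t ^ 16" by (simp add: power_add[symmetric] power_numeral_reduce mult_ac)
    also have "\<dots> \<le> T" by (rule T_low')
    also have "\<dots> \<le> T * x" using ord T0 by simp
    also have "\<dots> = c * t" using G_chain[of 0] p6 unfolding T_def c_def t_def x_def G_0 by (simp add: numeral_2_eq_2)
    finally have "8 * real k ^ 6 * Df ^ 4 \<le> c" by (rule mult_right_le_imp_le) (use t1 in simp)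
    also have "\<dots> \<le> x * b * c"
    proof -
      have "1 * 1 \<le> x * b" using ord by (intro mult_mono) auto
      then have "1 * c \<le> x * b * c" using ord by (intro mult_right_mono) auto
      then show ?thesis by simp
    qed
    finally show ?thesis unfolding x_def b_def c_def .
  qed
  have lm: "(1::nat) < 4" "(4::nat) < 5" "5 < p" using p6 by auto
  show False
  proof (rule thue_quadratic[OF lm big])
    have T3: "K ^ 3 * t ^ 16 \<le> T"
    proof -
      have "K ^ 3 * t ^ 16 \<le> K ^ 5 * t ^ 16" using K1 t1 by (intro mult_right_mono power_increasing) auto
      then show ?thesis using T_low' by linarith
    qed
    have "16 * (real k)\<^sup>2 * t ^ 4 \<le> 512 * real k ^ 4 * t ^ 16"
      using k1 t1 by (intro mult_mono power_increasing) auto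
    also have "\<dots> \<le> K ^ 3 * t ^ 16" using K3 t1 by (intro mult_right_mono) auto
    finally have 1: "16 * (real k)\<^sup>2 * t ^ 4 \<le> T" using T3 by linarith
    have 2: "2 * t < T"
    proof -
      have "2 * t < 16 * t ^ 4" using t1 power_increasing[of 1 4 t] by simp
      also have "16 * t ^ 4 \<le> 16 * (real k)\<^sup>2 * t ^ 4" using k1 t1 by (simp add: mult_le_cancel_right1 one_le_power)
      finally show ?thesis using 1 by linarith
    qed
    assume "(a 0 * a 5 / 2) ^ (k - 1) \<le> (16 * (real k)\<^sup>2 * (a 0 * a 1 * a 4) * Df) ^ k * (2 * a 1 * a 4)"
    moreover have "\<not> (x * d / 2) ^ (k - 1) \<le> (16 * (real k)\<^sup>2 * (x * b * c) * Df) ^ k * (2 * b * c)"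
      by (rule thue_linear_case_contradiction[OF k5 _ _ _ _ _ cT _ Dt 1 2 d_half]) (use ord D1 in auto)
    ultimately show False unfolding x_def b_def c_def d_def by contradiction
  next
    have "(128 * real k ^ 4 * Df ^ 3) ^ k * (128 * t ^ 5 * c ^ 3) < T ^ 6"
    proof -
      have "(128 * real k ^ 4 * Df ^ 3) ^ k * (128 * t ^ 5) \<le> (128 * real k ^ 4 * (t ^ 2) ^ 3) ^ k * (128 * t ^ 5)"
        using Dt D1 t1 by (intro mult_right_mono power_mono mult_left_mono) auto
      also have "\<dots> = 128 * ((128 * real k ^ 4) ^ k * t ^ (6 * k + 5))"
        by (simp add: power_mult_distrib power_mult[symmetric] power_add)
      also have "\<dots> < 4 ^ k * ((128 * real k ^ 4) ^ k * t ^ (6 * k + 5))"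
      proof (rule mult_strict_right_mono)
        have "(128::real) < 4 ^ 5" by simp
        also have "\<dots> \<le> 4 ^ k" using k5 by (intro power_increasing) auto
        finally show "(128::real) < 4 ^ k" .
      qed (use k1 t1 in \<open>auto intro!: mult_pos_pos zero_less_power\<close>)
      also have "\<dots> = (4 * (128 * real k ^ 4)) ^ k * t ^ (6 * k + 5)"
        by (simp only: power_mult_distrib mult.assoc)
      also have "\<dots> = (512 * real k ^ 4) ^ k * t ^ (6 * k + 5)" by simp
      also have "\<dots> \<le> (K ^ 3) ^ k * t ^ ((k - 1) * (k - 1) * 3)"
      proof (intro mult_mono power_mono power_increasing)
        obtain j where "k = j + 5" using k5 by (metis add.commute le_Suc_ex)
        then show "6 * k + 5 \<le> (k - 1) * (k - 1) * 3" by (simp add: algebra_simps)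
      qed (use K3 t1 K1 in auto)
      also have "\<dots> = (K ^ k * t ^ ((k - 1) * (k - 1))) ^ 3"
        by (simp add: power_mult_distrib power_mult[symmetric] mult.commute)
      also have "\<dots> \<le> T ^ 3" using T_low K1 t1 by (intro power_mono) auto
      finally have "(128 * real k ^ 4 * Df ^ 3) ^ k * (128 * t ^ 5) < T ^ 3" .
      \<comment> \<open>Three powers of \<open>T\<close> pay for the constants and \<open>t\<close>,
        three more for \<open>c\<close>; \<open>(k - 2) * (k - 3)\<close> equals \<open>6\<close> at
        \<open>k = 5\<close>.\<close>
      moreover have "c ^ 3 \<le> T ^ 3" "0 < c ^ 3" using cT ord by (auto intro: power_mono)
      ultimately have "((128 * real k ^ 4 * Df ^ 3) ^ k * (128 * t ^ 5)) * c ^ 3 < T ^ 3 * T ^ 3"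
        using D1 t1 by (intro mult_less_le_imp_less) auto
      then show ?thesis by (simp add: power_add[symmetric] mult.assoc)
    qed
    also have "\<dots> \<le> T ^ ((k - 2) * (k - 3))"
      using k5 mult_le_mono[of 3 "k - 2" 2 "k - 3"] cT ord by (intro power_increasing) auto
    finally have 1: "(128 * real k ^ 4 * Df ^ 3) ^ k * (128 * t ^ 5 * c ^ 3) < T ^ ((k - 2) * (k - 3))" .
    assume "(a 0 * a 5 / 2) ^ (k - 1) \<le> (128 * real k ^ 4 * Df ^ 3) ^ k * (2 * a 1 * a 4) ^ 3 * (2 * a 1 * a 5)\<^sup>2"
    moreover have "\<not> (x * d / 2) ^ (k - 1) \<le> (128 * real k ^ 4 * Df ^ 3) ^ k * (2 * b * c) ^ 3 * (2 * b * d)\<^sup>2"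
      by (rule thue_quadratic_case_contradiction[OF _ _ _ _ _ _ _ 1 d_half]) (use k5 ord D1 cT in auto)
    ultimately show False unfolding x_def b_def c_def d_def by contradiction
  qed
qed

text \<open>For \<open>\<bar>n\<bar> = 1\<close> the gap constant improves from
  \<open>k ^ k / 2 ^ (k - 1)\<close> to \<open>k ^ k / 2\<close>, so that \<open>a 3\<close> already
  passes the balance threshold and \<open>a 4\<close> gives the contradiction.\<close>

lemma no_chain_five_unit:
  assumes k6: "k \<ge> 6" and p5: "p \<ge> 5" and n1: "\<bar>n\<bar> = 1"
  shows False
proof -
  define x b t c d where "x = a 0" and "b = a 1" and "t = a 2" and "c = a 3" and "d = a 4"
  have ord: "1 \<le> x" "x < b" "b < t" "t < c" "3 \<le> t"
    unfolding x_def b_def t_def c_def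
    using a_ge_Suc[of 0] a_less[of 0 1] a_less[of 1 2] a_less[of 2 3] a_ge_Suc[of 2] p5 by auto
  define K' where "K' = real k ^ k / 2"
  have k1: "6 \<le> real k" using k6 by simp
  have K6: "real k ^ 6 / 2 \<le> K'"
    unfolding K'_def using k6 power_increasing[of 6 k "real k"] by simp
  \<comment> \<open>The product is at least \<open>3\<close>, so product plus \<open>n\<close> is a
    \<open>k\<close>-th power at least \<open>2\<close>, hence at least
    \<open>2 ^ k\<close>.\<close>
  have prod_low: "2 ^ k - 1 \<le> a i * a l" if "i < l" "2 \<le> l" "l < p" for i l
  proof -
    have "1 * 3 \<le> a i * a l"
      using a_ge_Suc[of i] a_ge_Suc[of l] that by (intro mult_mono) auto
    then have "real_of_int 3 \<le> of_int (int (A i) * int (A l))" by simp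
    then have 3: "3 \<le> int (A i) * int (A l)" by (simp only: of_int_le_iff)
    have "A i \<in> A ` {..<p}" "A l \<in> A ` {..<p}" "A i \<noteq> A l"
      "\<bar>n\<bar> < int (A i) * int (A l)" "k > 0"
      using A_less[of i l] that 3 n1 k by simp_all
    then obtain m where m: "m > 0" "int (A i) * int (A l) + n = m ^ k"
      by (rule diophantine_tuple_root[OF tuple])
    have "m \<noteq> 1" using m 3 n1 by auto
    then have "2 ^ k \<le> m ^ k" using m by (intro power_mono) auto
    then have "2 ^ k - 1 \<le> int (A i) * int (A l)" using m n1 by linarith
    then have "real_of_int (2 ^ k - 1) \<le> of_int (int (A i) * int (A l))" by (simp only: of_int_le_iff)
    then show ?thesis by simp
  qed
  have gap': "K' * (a i * a l) ^ (k - 1) \<le> a j * a m" if "i < j" "j < l" "l < m" "m < p" for i j l m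
  proof -
    define q where "q = a i * a l"
    have "real k \<le> 2 ^ (k - 1)"
    proof -
      have "k - 1 < 2 ^ (k - 1)" by (rule less_exp)
      then have "k \<le> 2 ^ (k - 1)" using k6 by linarith
      then have "real k \<le> real (2 ^ (k - 1))" by (simp only: of_nat_le_iff)
      then show ?thesis by simp
    qed
    moreover have "(2::real) ^ k = 2 * 2 ^ (k - 1)" using k6 by (cases k) auto
    ultimately have pow: "2 * real k \<le> 2 ^ k" by linarith
    have q: "2 * real (k - 1) \<le> q"
    proof -
      have "2 ^ k - 1 \<le> q" using prod_low[of i l] that unfolding q_def by simp
      moreover have "real (k - 1) = real k - 1" using k6 by (simp add: of_nat_diff)
      ultimately show ?thesis using pow by linarith
    qed
    have q1: "1 \<le> q" using q k6 by (simp add: of_nat_diff)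
    \<comment> \<open>By Bernoulli, subtracting \<open>1\<close> from \<open>q\<close> costs only a
      factor \<open>2\<close> in the whole power \<open>q ^ (k - 1)\<close>, because
      \<open>q \<ge> 2 * (k - 1)\<close>.\<close>
    have "1 / 2 \<le> 1 + real (k - 1) * (- (1 / q))" using q q1 by (simp add: field_simps)
    also have "\<dots> \<le> (1 + - (1 / q)) ^ (k - 1)" using q1 by (intro Bernoulli_inequality) simp
    finally have "1 / 2 * q ^ (k - 1) \<le> (1 + - (1 / q)) ^ (k - 1) * q ^ (k - 1)"
      using q1 by (intro mult_right_mono) auto
    also have "\<dots> = (q - 1) ^ (k - 1)"
      using q1 by (simp add: power_mult_distrib[symmetric] left_diff_distrib)
    finally have "real k ^ k * (1 / 2 * q ^ (k - 1)) \<le> real k ^ k * (q - 1) ^ (k - 1)"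
      by (intro mult_left_mono) auto
    also have "\<dots> \<le> a j * a m" using gap[OF that] n1 unfolding q_def by simp
    finally show ?thesis unfolding K'_def q_def by simp
  qed
  have K0: "0 < K'" unfolding K'_def using k1 by simp
  have g1: "K' * (x * t) ^ (k - 1) \<le> b * c"
    using gap'[of 0 1 2 3] p5 unfolding x_def b_def t_def c_def by simp
  have g2: "K' * (b * c) ^ (k - 1) \<le> t * d"
    using gap'[of 1 2 3 4] p5 unfolding b_def c_def t_def d_def by simp
  have c_low: "K' * t ^ 4 \<le> c"
  proof -
    have "K' * t ^ 4 * t = K' * t ^ 5" by (simp add: power_numeral_reduce mult_ac)
    also have "\<dots> \<le> K' * (x * t) ^ (k - 1)"
    proof -
      have "t ^ 5 \<le> t ^ (k - 1)" using k6 ord by (intro power_increasing) auto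
      also have "\<dots> \<le> (x * t) ^ (k - 1)" using ord by (intro power_mono) auto
      finally show ?thesis using K0 by simp
    qed
    also have "\<dots> \<le> c * t" using g1 ord by (smt (verit) mult.commute mult_left_mono)
    finally show ?thesis by (rule mult_right_le_imp_le) (use ord in simp)
  qed
  have d_low: "K' * c ^ (k - 2) \<le> d"
  proof -
    have "K' * c ^ (k - 2) * c = K' * c ^ (k - 1)"
      using k6 by (simp add: power_Suc2[symmetric] Suc_diff_Suc numeral_2_eq_2)
    also have "\<dots> \<le> K' * (b * c) ^ (k - 1)"
      using K0 ord by (intro mult_left_mono power_mono) auto
    also have "\<dots> \<le> t * d" by (rule g2)
    also have "\<dots> \<le> c * d" using ord unfolding d_def by (intro mult_right_mono) auto
    also have "\<dots> = d * c" by simp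
    finally show ?thesis by (rule mult_right_le_imp_le) (use ord in simp)
  qed
  have K2: "2 \<le> K'"
  proof -
    have "(6::real) ^ 6 \<le> real k ^ 6" using k1 by (intro power_mono) auto
    then show ?thesis using K6 by simp
  qed
  have d_half: "c ^ (k - 2) \<le> d / 2"
  proof -
    have "2 * c ^ (k - 2) \<le> K' * c ^ (k - 2)" using K2 ord by (intro mult_right_mono) auto
    then show ?thesis using d_low by linarith
  qed
  have D1: "1 \<le> Df" by (rule D_bounds)
  have Db: "Df \<le> b" using D_bounds(2) n1 unfolding b_def by simp
  have big: "8 * real k ^ 6 * Df ^ 4 \<le> a 0 * a 1 * a 3"
  proof -
    \<comment> \<open>Since \<open>K'\<close> dominates only \<open>k ^ 6 / 2\<close>, a factor
      \<open>16\<close> is missing; \<open>2 ^ k - 1 \<ge> 63\<close> supplies it.\<close>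
    have "63 \<le> x * t"
    proof -
      have "(2::real) ^ 6 \<le> 2 ^ k" using k6 by (intro power_increasing) auto
      then show ?thesis using prod_low[of 0 2] p5 unfolding x_def t_def by simp
    qed
    also have "\<dots> \<le> x ^ 6 * t" using ord power_increasing[of 1 6 x] by simp
    finally have "16 \<le> x ^ 6 * t" by simp
    have "8 * real k ^ 6 * Df ^ 4 \<le> 8 * real k ^ 6 * t ^ 4"
      using Db D1 ord by (intro mult_left_mono power_mono) auto
    also have "\<dots> = real k ^ 6 / 2 * (16 * t ^ 4)" by simp
    also have "\<dots> \<le> K' * ((x ^ 6 * t) * t ^ 4)"
      using K6 \<open>16 \<le> x ^ 6 * t\<close> ord K0 by (intro mult_mono) auto
    also have "\<dots> = x * (K' * (x * t) ^ 5)"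
      by (simp add: power_mult_distrib power_numeral_reduce mult_ac)
    also have "\<dots> \<le> x * (K' * (x * t) ^ (k - 1))"
      using ord K0 k6 \<open>63 \<le> x * t\<close> by (intro mult_left_mono power_increasing) auto
    also have "\<dots> \<le> x * (b * c)" using g1 ord by (intro mult_left_mono) auto
    finally show ?thesis unfolding x_def b_def c_def by simp
  qed
  have lm: "(1::nat) < 3" "(3::nat) < 4" "4 < p" using p5 by auto
  show False
  proof (rule thue_quadratic[OF lm big])
    have "16 * (real k)\<^sup>2 * t ^ 4 \<le> K' * t ^ 4"
    proof (intro mult_right_mono)
      have "(6::real) ^ 4 \<le> real k ^ 4" using k1 by (intro power_mono) auto
      then have "32 * (real k)\<^sup>2 \<le> real k ^ 4 * (real k)\<^sup>2" by (intro mult_right_mono) auto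
      then show "16 * (real k)\<^sup>2 \<le> K'" using K6 by (simp add: power_add[symmetric])
    qed (use ord in auto)
    then have 1: "16 * (real k)\<^sup>2 * t ^ 4 \<le> c" using c_low by linarith
    have 2: "2 * t < c"
    proof -
      have "2 * t < 16 * t ^ 4" using ord power_increasing[of 1 4 t] by simp
      also have "16 * t ^ 4 \<le> 16 * (real k)\<^sup>2 * t ^ 4" using k1 ord by (simp add: mult_le_cancel_right1 one_le_power)
      finally show ?thesis using 1 by linarith
    qed
    have Dt: "Df \<le> t ^ 2" using Db ord power_increasing[of 1 2 t] by simp
    assume "(a 0 * a 4 / 2) ^ (k - 1) \<le> (16 * (real k)\<^sup>2 * (a 0 * a 1 * a 3) * Df) ^ k * (2 * a 1 * a 3)"
    moreover have "\<not> (x * d / 2) ^ (k - 1) \<le> (16 * (real k)\<^sup>2 * (x * b * c) * Df) ^ k * (2 * b * c)"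
      by (rule thue_linear_case_contradiction[OF _ _ _ _ _ _ _ _ Dt 1 2 d_half]) (use ord D1 k6 in auto)
    ultimately show False unfolding x_def b_def c_def d_def by contradiction
  next
    define Y where "Y = 128 * real k ^ 4 * t ^ 3"
    have Y0: "0 < Y" unfolding Y_def using k1 ord by simp
    have c3: "Y ^ 2 * (8 * t ^ 6) \<le> c ^ 3"
    proof -
      have "Y ^ 2 * (8 * t ^ 6) = 2 ^ 17 * real k ^ 8 * t ^ 12"
        unfolding Y_def by (simp add: power_mult_distrib power_mult[symmetric] power_add[symmetric])
      also have "\<dots> \<le> (real k ^ 6 / 2) ^ 3 * t ^ 12"
      proof (intro mult_right_mono)
        have "(6::real) ^ 10 \<le> real k ^ 10" using k1 by (intro power_mono) auto
        then have "2 ^ 20 * real k ^ 8 \<le> real k ^ 10 * real k ^ 8" by (intro mult_right_mono) auto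
        then show "2 ^ 17 * real k ^ 8 \<le> (real k ^ 6 / 2) ^ 3"
          by (simp add: power_divide power_mult[symmetric] power_add[symmetric])
      qed (use ord in auto)
      also have "\<dots> \<le> K' ^ 3 * t ^ 12" using K6 ord by (intro mult_right_mono power_mono) auto
      also have "\<dots> = (K' * t ^ 4) ^ 3" by (simp add: power_mult_distrib)
      also have "\<dots> \<le> c ^ 3" using c_low K0 ord by (intro power_mono) auto
      finally show ?thesis .
    qed
    \<comment> \<open>\<open>c3\<close> bounds \<open>Y\<^sup>2\<close>, so the estimate is squared
      to avoid half-integral exponents; \<open>3 * k \<le> 2 * (2 * k - 3)\<close> is an equality at
      \<open>k = 6\<close>.\<close>
    have "(Y ^ k * (128 * t ^ 5))\<^sup>2 = (Y ^ 2) ^ k * (128 ^ 2 * t ^ 10)"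
      by (simp add: power_mult_distrib power_mult[symmetric] mult.commute)
    also have "\<dots> < (Y ^ 2) ^ k * (8 ^ k * (t ^ 6) ^ k)"
    proof (rule mult_strict_left_mono)
      have "(128::real) ^ 2 < 8 ^ 6" by simp
      also have "(8::real) ^ 6 \<le> 8 ^ k" using k6 by (intro power_increasing) auto
      finally have 8: "(128::real) ^ 2 < 8 ^ k" .
      have "t ^ 10 \<le> (t ^ 6) ^ k"
        unfolding power_mult[symmetric] using ord k6 by (intro power_increasing) auto
      with 8 show "(128::real) ^ 2 * t ^ 10 < 8 ^ k * (t ^ 6) ^ k"
        using ord by (intro mult_less_le_imp_less) auto
    qed (use Y0 in simp)
    also have "\<dots> = (Y ^ 2 * (8 * t ^ 6)) ^ k" by (simp add: power_mult_distrib)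
    also have "\<dots> \<le> (c ^ 3) ^ k" using c3 Y0 ord by (intro power_mono) auto
    also have "\<dots> = c ^ (3 * k)" by (simp add: power_mult)
    also have "\<dots> \<le> c ^ ((2 * k - 3) * 2)" using ord k6 by (intro power_increasing) auto
    also have "\<dots> = (c ^ (2 * k - 3))\<^sup>2" by (rule power_mult)
    finally have Yc: "Y ^ k * (128 * t ^ 5) < c ^ (2 * k - 3)"
      by (rule power_less_imp_less_base) (use ord in simp)
    have "(128 * real k ^ 4 * Df ^ 3) ^ k * (128 * t ^ 5 * c ^ 3) \<le> Y ^ k * (128 * t ^ 5 * c ^ 3)"
      unfolding Y_def using Db D1 ord by (intro mult_right_mono power_mono mult_left_mono) auto
    also have "\<dots> = (Y ^ k * (128 * t ^ 5)) * c ^ 3" by simp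
    also have "\<dots> < c ^ (2 * k - 3) * c ^ 3" using Yc ord by (intro mult_strict_right_mono) auto
    also have "\<dots> = c ^ (2 * k)" using k6 by (simp add: power_add[symmetric])
    \<comment> \<open>The inequality between the exponents is again sharp at
      \<open>k = 6\<close>.\<close>
    also have "\<dots> \<le> c ^ ((k - 2) * (k - 3))"
    proof (rule power_increasing)
      obtain j where "k = j + 6" using k6 by (metis add.commute le_Suc_ex)
      then show "2 * k \<le> (k - 2) * (k - 3)" by (simp add: algebra_simps)
    qed (use ord in simp)
    finally have 1: "(128 * real k ^ 4 * Df ^ 3) ^ k * (128 * t ^ 5 * c ^ 3) < c ^ ((k - 2) * (k - 3))" .
    assume "(a 0 * a 4 / 2) ^ (k - 1) \<le> (128 * real k ^ 4 * Df ^ 3) ^ k * (2 * a 1 * a 3) ^ 3 * (2 * a 1 * a 4)\<^sup>2"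
    moreover have "\<not> (x * d / 2) ^ (k - 1) \<le> (128 * real k ^ 4 * Df ^ 3) ^ k * (2 * b * c) ^ 3 * (2 * b * d)\<^sup>2"
      by (rule thue_quadratic_case_contradiction[OF _ _ _ _ _ _ _ 1 d_half]) (use k6 ord D1 in auto)
    ultimately show False unfolding x_def b_def c_def d_def by contradiction
  qed
qed

end

section \<open>Bounds for the size of the tuples\<close>

lemma ecard_gt_obtain_chain:
  fixes B :: "nat set"
  assumes "enat r < ecard B"
  obtains A :: "nat \<Rightarrow> nat" where "strict_mono_on {..<Suc r} A" "A ` {..<Suc r} \<subseteq> B"
proof -
  obtain F where F: "finite F" "card F = Suc r" "F \<subseteq> B"
  proof (cases "finite B")
    case True
    then have "Suc r \<le> card B" using assms by (simp add: ecard_def)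
    then show ?thesis using that by (meson obtain_subset_with_card_n)
  next
    case False
    then show ?thesis using that by (meson infinite_arbitrarily_large)
  qed
  define A where "A = (\<lambda>i. sorted_list_of_set F ! i)"
  have len: "length (sorted_list_of_set F) = Suc r" using F by simp
  have "strict_mono_on {..<Suc r} A"
  proof (rule strict_mono_onI)
    fix i j assume "j \<in> {..<Suc r}" "i < j"
    then show "A i < A j"
      unfolding A_def using sorted_wrt_nth_less[OF strict_sorted_list_of_set[of F], of i j] len by simp
  qed
  moreover have "A ` {..<Suc r} \<subseteq> F"
    unfolding A_def using len F(1) nth_mem[of _ "sorted_list_of_set F"] by auto
  ultimately show ?thesis using F(3) by (intro that) auto
qed

text \<open>Serves both halves of the theorem: \<open>B\<close> is the whole tuple if
  \<open>\<bar>n\<bar> = 1\<close>, and its part beyond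
  \<open>\<bar>n\<bar> powr (k / (k - 2))\<close> otherwise. More than \<open>r\<close> elements
  yield a chain of length \<open>r + 1\<close>; the conditions on \<open>r\<close> correspond to the
  excluded lengths \<open>10\<close>, \<open>7\<close>, \<open>6\<close> and
  \<open>5\<close>.\<close>

lemma ecard_large_part_le:
  fixes k r :: nat and n :: int
  assumes k: "k \<ge> 3" and n: "n \<noteq> 0" and C: "diophantine_tuple k n C" and B: "B \<subseteq> C"
    and large: "\<And>c. c \<in> B \<Longrightarrow> \<bar>n\<bar> ^ k \<le> int c ^ (k - 2)"
    and r: "k = 3 \<Longrightarrow> 9 \<le> r" "k = 4 \<Longrightarrow> 6 \<le> r" "5 \<le> r \<or> (k \<ge> 6 \<and> \<bar>n\<bar> = 1 \<and> 4 \<le> r)"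
  shows "ecard B \<le> enat r"
proof (rule ccontr)
  assume "\<not> ecard B \<le> enat r"
  then have "enat r < ecard B" by simp
  then obtain A where A: "strict_mono_on {..<Suc r} A" "A ` {..<Suc r} \<subseteq> B"
    by (rule ecard_gt_obtain_chain)
  interpret diophantine_chain k "Suc r" n A
  proof
    have "A ` {..<Suc r} \<subseteq> C" using A(2) B by simp
    then show "diophantine_tuple k n (A ` {..<Suc r})"
      using C unfolding diophantine_tuple_def by (meson subsetD)
    show "\<bar>n\<bar> ^ k \<le> int (A 0) ^ (k - 2)" using A(2) by (intro large) auto
  qed (use k n A r in auto)
  consider "k = 3" | "k = 4" | "k \<ge> 5" using k by linarith
  then show False
    using no_chain_cubic no_chain_quartic no_chain_six no_chain_five_unit r by cases auto
qed

theorem theorem2p4: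
  fixes k :: nat and n :: int
  assumes "k \<ge> 3" and "n \<noteq> 0"
  shows "(\<bar>n\<bar> = 1 \<longrightarrow> M_sup k n \<le> enat (r_bound k)) \<and>
         (\<bar>n\<bar> \<ge> 2 \<longrightarrow> M_sup_from k n (real k / (real k - 2)) \<le> enat (u_bound k))"
proof (intro conjI impI)
  assume n1: "\<bar>n\<bar> = 1"
  show "M_sup k n \<le> enat (r_bound k)"
    unfolding M_sup_def
  proof (rule SUP_least)
    fix C assume "C \<in> {C. diophantine_tuple k n C}"
    then have C: "diophantine_tuple k n C" by simp
    show "ecard C \<le> enat (r_bound k)"
    proof (rule ecard_large_part_le[OF assms C order_refl])
      fix c assume "c \<in> C"
      then have "0 < c" using C unfolding diophantine_tuple_def by blast
      then show "\<bar>n\<bar> ^ k \<le> int c ^ (k - 2)" unfolding n1 by simp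
    qed (use n1 assms(1) in \<open>auto simp: r_bound_def\<close>)
  qed
next
  assume "\<bar>n\<bar> \<ge> 2"
  show "M_sup_from k n (real k / (real k - 2)) \<le> enat (u_bound k)"
    unfolding M_sup_from_def
  proof (rule SUP_least)
    fix C assume "C \<in> {C. diophantine_tuple k n C}"
    then have C: "diophantine_tuple k n C" by simp
    show "ecard {c \<in> C. real_of_int \<bar>n\<bar> powr (real k / (real k - 2)) \<le> real c} \<le> enat (u_bound k)"
    proof (rule ecard_large_part_le[OF assms C])
      fix c assume "c \<in> {c \<in> C. real_of_int \<bar>n\<bar> powr (real k / (real k - 2)) \<le> real c}"
      \<comment> \<open>Raising to the power \<open>k - 2\<close> turns the real exponent into the
        integer inequality required of a chain.\<close>
      then have "(real_of_int \<bar>n\<bar> powr (real k / (real k - 2))) ^ (k - 2) \<le> real c ^ (k - 2)"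
        by (intro power_mono) auto
      also have "(real_of_int \<bar>n\<bar> powr (real k / (real k - 2))) ^ (k - 2)
          = real_of_int \<bar>n\<bar> powr (real k / (real k - 2) * real (k - 2))"
        using assms by (simp add: powr_realpow[symmetric] powr_powr)
      also have "real k / (real k - 2) * real (k - 2) = real k"
        using assms by (simp add: of_nat_diff)
      also have "real_of_int \<bar>n\<bar> powr real k = real_of_int \<bar>n\<bar> ^ k"
        using assms by (simp add: powr_realpow)
      finally have "real_of_int (\<bar>n\<bar> ^ k) \<le> of_int (int c ^ (k - 2))" by simp
      then show "\<bar>n\<bar> ^ k \<le> int c ^ (k - 2)" by (simp only: of_int_le_iff)
    qed (use assms(1) in \<open>auto simp: u_bound_def\<close>)
  qed
qed

end
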